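(* Let $A\in\mathbb{Z}^{d\times n}$ have rank $d$ with columns lying in an affine hyperplane of $\mathbb{Q}^d$ not containing the origin, let $\beta\in\mathbb{C}^d$, and let $w\in\mathbb{R}^n$ be a generic weight vector. For every fake exponent $v$ of $H_A(\beta)$ with respect to $w$, $$\sum_{q\geq0}\dim_{\mathbb{C}}(Q_v^{\perp})_q\,t^q=H_{w,v}(t).$$ Consequently, $$\max\{q\geq0\mid(Q_v^{\perp})_q\neq0\}=\operatorname{fdeg}_w(v)\quad\text{and}\quad\operatorname{frank}_w(v)=H_{w,v}(1).$$
   Context: Notation: $\mathbb{N}=\{0,1,2,\ldots\}$, $[n]=\{1,\ldots,n\}$, $L=\ker_{\mathbb{Z}}(A)$. The toric ideal is $I_A=\langle\partial^u-\partial^{u'}\mid Au=Au',\ u,u'\in\mathbb{N}^n\rangle\subseteq\mathbb{C}[\partial_1,\ldots,\partial_n]$. $\operatorname{in}_w(I_A)$ is the ideal generated by the $w$-initial forms (sums of terms of maximal $w$-weight) of elements of $I_A$; "$w$ generic" means in particular that $\operatorname{in}_w(I_A)$ is a monomial ideal. Let $D=\mathbb{C}\langle x_1,\ldots,x_n,\partial_1,\ldots,\partial_n\rangle$ be the Weyl algebra and $\vartheta_j=x_j\partial_j$. $H_A(\beta)$ is the left ideal of $D$ generated by $I_A$ and the Euler operators $\sum_j a_{ij}\vartheta_j-\beta_i$. The fake indicial ideal is $(D\cdot\operatorname{in}_w(I_A)\cap\mathbb{C}[\vartheta])+\langle A\vartheta-\beta\rangle\subseteq\mathbb{C}[\vartheta]$;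 a zero $v\in\mathbb{C}^n$ of it is called a fake exponent of $H_A(\beta)$ with respect to $w$. $\operatorname{nsupp}(z)=\{j\in[n]\mid z_j\in\mathbb{Z}_{<0}\}$ for $z\in\mathbb{C}^n$. For $u\in L$ put $I_u=\operatorname{nsupp}(v+u)$, so $I_0=\operatorname{nsupp}(v)$; put $V=[n]\setminus I_0$. A standard pair of a monomial ideal $M\subseteq\mathbb{C}[\partial]$ is a pair $(a,\sigma)$, $a\in\mathbb{N}^n$, $\sigma\subseteq[n]$, such that (i) $a_i=0$ for $i\in\sigma$; (ii) $\partial^a\prod_{j\in\sigma}\partial_j^{b_j}\notin M$ for all $b_j\in\mathbb{N}$; (iii) for every $\ell\notin\sigma$ there are $b_j\in\mathbb{N}$ ($j\in\sigma\cup\{\ell\}$) with $\partial^a\prod_{j\in\sigma\cup\{\ell\}}\partial_j^{b_j}\in M$. $\mathcal{S}(M)$ is the set of standard pairs, and $\mathcal{S}_w(v)=\{(a,\sigma)\in\mathcal{S}(\operatorname{in}_w(I_A))\mid v_j=a_j\text{ for every }j\notin\sigma\}$. (Known criterion: $v$ is a fake exponent iff $Av=\beta$ and $\mathcal{S}_w(v)\neq\emptyset$.) $\Delta_w(v)=\{\tau\subseteq[n]\mid\tau\subseteq\sigma\text{ for some }(a,\sigma)\in\mathcal{S}_w(v)\}$, and $\operatorname{link}_v=\{\tau\in\Delta_w(v)\mid\tau\cap I_0=\emptyset,\ \tau\cup I_0\in\Delta_w(v)\}$, regarded as a simplicial complex on the vertex set $V$ (some elements of $V$ may be nonfaces). For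 a simplicial complex $\Delta$ on $V$, $I_\Delta=\langle\prod_{i\in\tau}x_i\mid\tau\subseteq V,\ \tau\notin\Delta\rangle$ and $\mathbb{C}[\Delta]=\mathbb{C}[x_i\mid i\in V]/I_\Delta$. Let $\{\partial^{g_+^{(i)}}-\partial^{g_-^{(i)}}\mid i=1,\ldots,m\}$ be the reduced Gröbner basis of $I_A$ with respect to $w$, with $\partial^{g_+^{(i)}}\in\operatorname{in}_w(I_A)$; put $g^{(i)}=g_+^{(i)}-g_-^{(i)}$ and $G^{(i)}=I_{-g^{(i)}}\setminus I_0$. Let $T=\mathbb{C}[\theta_1,\ldots,\theta_n]$, $\langle A\theta\rangle=\langle\sum_j a_{ij}\theta_j\mid i=1,\ldots,d\rangle$, $M_\theta(v)=\langle\prod_{j\in G^{(i)}}\theta_j\mid i=1,\ldots,m\rangle$, and $Q_v=\langle A\theta\rangle+M_\theta(v)\subseteq T$. For a homogeneous ideal $Q\subseteq T$, $Q^\perp=\{f\in\mathbb{C}[z_1,\ldots,z_n]\mid\phi(\partial_z)\bullet f=0\text{ for all }\phi\in Q\}$, and $(Q^\perp)_q$ is its degree-$q$ part. Write $k=|I_0|$, $I_0=\{i_1,\ldots,i_k\}$. By row reduction, $\langle A\theta\rangle$ has generators $\theta_{i_p}-L_p(\theta_V)$ ($1\le p\le k$), $\ell_q(\theta_V)$ ($1\le q\le d-k$), with $L_p,\ell_q$ linear forms in the variables $\theta_j$, $j\in V$. Via $\theta_j\mapsto x_j$ regard $\ell_q\in\mathbb{C}[\operatorname{link}_v]$, and define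 $$\mathcal{A}_{w,v}=\mathbb{C}[\operatorname{link}_v]/(\ell_1,\ldots,\ell_{d-|I_0|}),\qquad H_{w,v}(t)=\operatorname{Hilb}(\mathcal{A}_{w,v},t),$$ the Hilbert series, which is a polynomial since $\mathcal{A}_{w,v}$ is finite-dimensional, and does not depend on the choice of the $L_p,\ell_q$. Finally $\operatorname{fdeg}_w(v)=\deg H_{w,v}(t)$ and $\operatorname{frank}_w(v)=\dim_{\mathbb{C}}Q_v^\perp$. *)

theory Defs
  imports
    "HOL-Analysis.Analysis"
    "HOL-Library.Poly_Mapping"
    "HOL-Computational_Algebra.Polynomial_FPS"
begin

type_synonym 'n expo = "'n \<Rightarrow>\<^sub>0 nat"
type_synonym 'n mpoly = "('n \<Rightarrow>\<^sub>0 nat) \<Rightarrow>\<^sub>0 complex"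

definition mon :: "'n expo \<Rightarrow> 'n mpoly" where
  "mon u = Poly_Mapping.single u 1"

definition pconst :: "complex \<Rightarrow> 'n mpoly" where
  "pconst c = Poly_Mapping.single 0 c"

definition pvar :: "'n \<Rightarrow> 'n mpoly" where
  "pvar j = mon (Poly_Mapping.single j 1)"

definition cscale :: "complex \<Rightarrow> 'n mpoly \<Rightarrow> 'n mpoly" where
  "cscale c p = pconst c * p"

lemma vector_space_cscale: "vector_space cscale"
  by unfold_locales
     (simp_all add: cscale_def pconst_def algebra_simps single_add mult_single
        flip: mult.assoc)

global_interpretation cpoly: vector_space "cscale :: complex \<Rightarrow> 'n mpoly \<Rightarrow> 'n mpoly"
  by (rule vector_space_cscale)

definition eval_mpoly :: "complex ^ 'n::finite \<Rightarrow> 'n mpoly \<Rightarrow> complex" where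
  "eval_mpoly v p =
     (\<Sum>u\<in>Poly_Mapping.keys p. Poly_Mapping.lookup p u *
        (\<Prod>j\<in>UNIV. (v $ j) ^ Poly_Mapping.lookup u j))"

definition expo_degree :: "'n::finite expo \<Rightarrow> nat" where
  "expo_degree u = (\<Sum>j\<in>UNIV. Poly_Mapping.lookup u j)"

definition homogeneous_part :: "nat \<Rightarrow> 'n::finite mpoly set" where
  "homogeneous_part q = {p. \<forall>u\<in>Poly_Mapping.keys p. expo_degree u = q}"

text \<open>The ideal generated by a set, as the span in the ring regarded as a module over itself.\<close>

definition ideal_gen :: "'a::comm_ring_1 set \<Rightarrow> 'a set" where
  "ideal_gen S = module.span (*) S"

definition ideal_sum :: "'a::comm_ring_1 set \<Rightarrow> 'a set \<Rightarrow> 'a set" where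
  "ideal_sum I J = {p + q | p q. p \<in> I \<and> q \<in> J}"

definition monomial_ideal :: "'n mpoly set \<Rightarrow> bool" where
  "monomial_ideal M \<longleftrightarrow> (\<exists>U. M = ideal_gen (mon ` U))"

definition homogeneous_matrix :: "int ^ 'n ^ 'd::finite \<Rightarrow> bool" where
  "homogeneous_matrix A \<longleftrightarrow>
     (\<exists>(h :: rat ^ 'd) c. h \<noteq> 0 \<and> c \<noteq> 0 \<and>
        (\<forall>j. (\<Sum>i\<in>UNIV. h $ i * of_int (A $ i $ j)) = c))"

definition rat_matrix :: "int ^ 'n::finite ^ 'd::finite \<Rightarrow> rat ^ 'n ^ 'd" where
  "rat_matrix A = (\<chi> i j. of_int (A $ i $ j))"

definition mult_expo :: "int ^ 'n::finite ^ 'd::finite \<Rightarrow> 'n expo \<Rightarrow> int ^ 'd" where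
  "mult_expo A u = (\<chi> i. \<Sum>j\<in>UNIV. A $ i $ j * int (Poly_Mapping.lookup u j))"

definition toric_ideal :: "int ^ 'n::finite ^ 'd::finite \<Rightarrow> 'n mpoly set" where
  "toric_ideal A = ideal_gen {mon u - mon u' | u u'. mult_expo A u = mult_expo A u'}"

definition weight :: "real ^ 'n::finite \<Rightarrow> 'n expo \<Rightarrow> real" where
  "weight w u = (\<Sum>j\<in>UNIV. w $ j * real (Poly_Mapping.lookup u j))"

definition initial_form :: "real ^ 'n::finite \<Rightarrow> 'n mpoly \<Rightarrow> 'n mpoly" where
  "initial_form w f =
     (\<Sum>u\<in>{u \<in> Poly_Mapping.keys f. \<forall>u'\<in>Poly_Mapping.keys f. weight w u' \<le> weight w u}.
        Poly_Mapping.single u (Poly_Mapping.lookup f u))"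

definition initial_ideal :: "real ^ 'n::finite \<Rightarrow> 'n mpoly set \<Rightarrow> 'n mpoly set" where
  "initial_ideal w I = ideal_gen (initial_form w ` I)"

definition generic_weight :: "int ^ 'n::finite ^ 'd::finite \<Rightarrow> real ^ 'n \<Rightarrow> bool" where
  "generic_weight A w \<longleftrightarrow> monomial_ideal (initial_ideal w (toric_ideal A))"

definition is_reduced_groebner_basis ::
    "real ^ 'n::finite \<Rightarrow> 'n mpoly set \<Rightarrow> 'n mpoly set \<Rightarrow> bool" where
  "is_reduced_groebner_basis w I G \<longleftrightarrow>
     finite G \<and> ideal_gen G = I \<and>
     ideal_gen (initial_form w ` G) = initial_ideal w I \<and>
     (\<forall>g\<in>G. (\<exists>u. initial_form w g = mon u) \<and>
        (\<forall>t\<in>Poly_Mapping.keys g. mon t \<notin> ideal_gen (initial_form w ` (G - {g}))))"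

definition pderivative :: "'n \<Rightarrow> 'n mpoly \<Rightarrow> 'n mpoly" where
  "pderivative j f =
     (\<Sum>u\<in>Poly_Mapping.keys f.
        Poly_Mapping.single (u - Poly_Mapping.single j 1)
          (Poly_Mapping.lookup f u * of_nat (Poly_Mapping.lookup u j)))"

definition euler_op :: "'n \<Rightarrow> 'n mpoly \<Rightarrow> 'n mpoly" where
  "euler_op j f = pvar j * pderivative j f"

text \<open>The Weyl algebra is realised, as is possible in characteristic 0, as the algebra of
  differential operators with polynomial coefficients acting on the polynomial ring;
  the product is composition.\<close>

inductive_set weyl_algebra :: "('n mpoly \<Rightarrow> 'n mpoly) set" where
  const: "cscale c \<in> weyl_algebra"
| var: "(\<lambda>f. pvar j * f) \<in> weyl_algebra"
| deriv: "pderivative j \<in> weyl_algebra"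
| add: "P \<in> weyl_algebra \<Longrightarrow> Q \<in> weyl_algebra \<Longrightarrow> (\<lambda>f. P f + Q f) \<in> weyl_algebra"
| mult: "P \<in> weyl_algebra \<Longrightarrow> Q \<in> weyl_algebra \<Longrightarrow> P \<circ> Q \<in> weyl_algebra"

definition weyl_left_ideal ::
    "('n mpoly \<Rightarrow> 'n mpoly) set \<Rightarrow> ('n mpoly \<Rightarrow> 'n mpoly) set" where
  "weyl_left_ideal S =
     {(\<lambda>f. \<Sum>i<k. P i (Q i f)) | (k::nat) P Q. \<forall>i<k. P i \<in> weyl_algebra \<and> Q i \<in> S}"

text \<open>Substitution of pairwise commuting operators for the variables of a polynomial.
  The fold is the composition of the powers; its order is immaterial
  because the operators commute.\<close>

definition op_monomial ::
    "('n::finite \<Rightarrow> 'n mpoly \<Rightarrow> 'n mpoly) \<Rightarrow> 'n expo \<Rightarrow> 'n mpoly \<Rightarrow> 'n mpoly" where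
  "op_monomial X u = Finite_Set.fold (\<lambda>j F. (X j ^^ Poly_Mapping.lookup u j) \<circ> F) id UNIV"

definition op_subst ::
    "('n::finite \<Rightarrow> 'n mpoly \<Rightarrow> 'n mpoly) \<Rightarrow> 'n mpoly \<Rightarrow> 'n mpoly \<Rightarrow> 'n mpoly" where
  "op_subst X p f =
     (\<Sum>u\<in>Poly_Mapping.keys p. cscale (Poly_Mapping.lookup p u) (op_monomial X u f))"

definition row_form :: "int ^ 'n::finite ^ 'd::finite \<Rightarrow> 'd \<Rightarrow> 'n mpoly" where
  "row_form A i = (\<Sum>j\<in>UNIV. pconst (of_int (A $ i $ j)) * pvar j)"

definition fake_indicial_ideal ::
    "int ^ 'n::finite ^ 'd::finite \<Rightarrow> complex ^ 'd \<Rightarrow> real ^ 'n \<Rightarrow> 'n mpoly set" where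
  "fake_indicial_ideal A \<beta> w =
     ideal_sum
       {p. op_subst euler_op p \<in>
             weyl_left_ideal (op_subst pderivative ` initial_ideal w (toric_ideal A))}
       (ideal_gen (range (\<lambda>i. row_form A i - pconst (\<beta> $ i))))"

definition fake_exponent ::
    "int ^ 'n::finite ^ 'd::finite \<Rightarrow> complex ^ 'd \<Rightarrow> real ^ 'n \<Rightarrow> complex ^ 'n \<Rightarrow> bool" where
  "fake_exponent A \<beta> w v \<longleftrightarrow> (\<forall>p\<in>fake_indicial_ideal A \<beta> w. eval_mpoly v p = 0)"

definition nsupp :: "complex ^ 'n \<Rightarrow> 'n set" where
  "nsupp z = {j. \<exists>m::int. m < 0 \<and> z $ j = of_int m}"

definition nsupp_shift :: "complex ^ 'n::finite \<Rightarrow> int ^ 'n \<Rightarrow> 'n set" where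
  "nsupp_shift v u = nsupp (\<chi> j. v $ j + of_int (u $ j))"

definition standard_pairs :: "'n mpoly set \<Rightarrow> ('n expo \<times> 'n set) set" where
  "standard_pairs M = {(a, \<sigma>).
     (\<forall>i\<in>\<sigma>. Poly_Mapping.lookup a i = 0) \<and>
     (\<forall>b. Poly_Mapping.keys b \<subseteq> \<sigma> \<longrightarrow> mon (a + b) \<notin> M) \<and>
     (\<forall>l. l \<notin> \<sigma> \<longrightarrow> (\<exists>b. Poly_Mapping.keys b \<subseteq> insert l \<sigma> \<and> mon (a + b) \<in> M))}"

definition standard_pairs_at ::
    "int ^ 'n::finite ^ 'd::finite \<Rightarrow> real ^ 'n \<Rightarrow> complex ^ 'n \<Rightarrow> ('n expo \<times> 'n set) set" where
  "standard_pairs_at A w v =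
     {(a, \<sigma>) \<in> standard_pairs (initial_ideal w (toric_ideal A)).
        \<forall>j. j \<notin> \<sigma> \<longrightarrow> v $ j = of_nat (Poly_Mapping.lookup a j)}"

definition Delta_complex ::
    "int ^ 'n::finite ^ 'd::finite \<Rightarrow> real ^ 'n \<Rightarrow> complex ^ 'n \<Rightarrow> 'n set set" where
  "Delta_complex A w v = {\<tau>. \<exists>(a, \<sigma>)\<in>standard_pairs_at A w v. \<tau> \<subseteq> \<sigma>}"

definition link_complex ::
    "int ^ 'n::finite ^ 'd::finite \<Rightarrow> real ^ 'n \<Rightarrow> complex ^ 'n \<Rightarrow> 'n set set" where
  "link_complex A w v =
     {\<tau> \<in> Delta_complex A w v. \<tau> \<inter> nsupp v = {} \<and> \<tau> \<union> nsupp v \<in> Delta_complex A w v}"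

text \<open>A Groebner basis of binomials is given by the exponents
  \<^term>\<open>gp i\<close> and \<^term>\<open>gm i\<close> of its elements for \<^term>\<open>i \<in> {1..m::nat}\<close>.\<close>

definition G_set :: "complex ^ 'n::finite \<Rightarrow> 'n expo \<Rightarrow> 'n expo \<Rightarrow> 'n set" where
  "G_set v p m =
     nsupp_shift v (- (\<chi> j. int (Poly_Mapping.lookup p j) - int (Poly_Mapping.lookup m j)))
       - nsupp v"

definition M_ideal ::
    "complex ^ 'n::finite \<Rightarrow> nat \<Rightarrow> (nat \<Rightarrow> 'n expo) \<Rightarrow> (nat \<Rightarrow> 'n expo) \<Rightarrow> 'n mpoly set" where
  "M_ideal v m gp gm = ideal_gen ((\<lambda>i. \<Prod>j\<in>G_set v (gp i) (gm i). pvar j) ` {1..m})"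

definition Q_ideal ::
    "int ^ 'n::finite ^ 'd::finite \<Rightarrow> complex ^ 'n \<Rightarrow>
     nat \<Rightarrow> (nat \<Rightarrow> 'n expo) \<Rightarrow> (nat \<Rightarrow> 'n expo) \<Rightarrow> 'n mpoly set" where
  "Q_ideal A v m gp gm = ideal_sum (ideal_gen (range (row_form A))) (M_ideal v m gp gm)"

definition perp :: "'n::finite mpoly set \<Rightarrow> 'n mpoly set" where
  "perp Q = {f. \<forall>\<phi>\<in>Q. op_subst pderivative \<phi> f = 0}"

definition frank ::
    "int ^ 'n::finite ^ 'd::finite \<Rightarrow> complex ^ 'n \<Rightarrow>
     nat \<Rightarrow> (nat \<Rightarrow> 'n expo) \<Rightarrow> (nat \<Rightarrow> 'n expo) \<Rightarrow> nat" where
  "frank A v m gp gm = cpoly.dim (perp (Q_ideal A v m gp gm))"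

definition polys_in :: "'n set \<Rightarrow> 'n mpoly set" where
  "polys_in V = {p. \<forall>u\<in>Poly_Mapping.keys p. Poly_Mapping.keys u \<subseteq> V}"

definition linear_form_in :: "'n set \<Rightarrow> 'n mpoly \<Rightarrow> bool" where
  "linear_form_in V p \<longleftrightarrow> (\<exists>c. p = (\<Sum>j\<in>V. pconst (c j) * pvar j))"

text \<open>The ideal of the subring \<^term>\<open>polys_in V\<close> generated by a subset of that subring.\<close>

definition ideal_gen_in :: "'n set \<Rightarrow> 'n mpoly set \<Rightarrow> 'n mpoly set" where
  "ideal_gen_in V S =
     {(\<Sum>s\<in>F. r s * s) | F r. finite F \<and> F \<subseteq> S \<and> (\<forall>s\<in>F. r s \<in> polys_in V)}"

definition stanley_reisner_ideal :: "'n set \<Rightarrow> 'n set set \<Rightarrow> 'n mpoly set" where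
  "stanley_reisner_ideal V \<Delta> =
     ideal_gen_in V {(\<Prod>i\<in>\<tau>. pvar i) | \<tau>. \<tau> \<subseteq> V \<and> \<tau> \<notin> \<Delta>}"

text \<open>The dimension of the quotient space \<open>W / (W \<inter> U)\<close>: the number of elements of a finite
  family in \<open>W\<close> whose classes form a basis.\<close>

definition quot_dim :: "'n mpoly set \<Rightarrow> 'n mpoly set \<Rightarrow> nat" where
  "quot_dim W U =
     (THE n. \<exists>B. finite B \<and> B \<subseteq> W \<and> card B = n \<and>
        (\<forall>p\<in>W. \<exists>!c. (\<forall>b. b \<notin> B \<longrightarrow> c b = 0) \<and> p - (\<Sum>b\<in>B. cscale (c b) b) \<in> U))"

definition hilbert_series :: "'n::finite set \<Rightarrow> 'n mpoly set \<Rightarrow> int fps" where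
  "hilbert_series V J = Abs_fps (\<lambda>q. int (quot_dim (polys_in V \<inter> homogeneous_part q) J))"

text \<open>Row reduction of the ideal of the row forms of \<open>A\<close> with respect to \<open>I\<^sub>0\<close>; the forms
  expressing the variables in \<open>I\<^sub>0\<close> are indexed by \<open>I\<^sub>0\<close> itself.\<close>

definition row_reduction ::
    "int ^ 'n::finite ^ 'd::finite \<Rightarrow> 'n set \<Rightarrow> ('n \<Rightarrow> 'n mpoly) \<Rightarrow> (nat \<Rightarrow> 'n mpoly) \<Rightarrow> bool" where
  "row_reduction A I\<^sub>0 L ell \<longleftrightarrow>
     (\<forall>i\<in>I\<^sub>0. linear_form_in (- I\<^sub>0) (L i)) \<and>
     (\<forall>q\<in>{1..CARD('d) - card I\<^sub>0}. linear_form_in (- I\<^sub>0) (ell q)) \<and>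
     ideal_gen ((\<lambda>i. pvar i - L i) ` I\<^sub>0 \<union> ell ` {1..CARD('d) - card I\<^sub>0}) =
       ideal_gen (range (row_form A))"

text \<open>The kernel of the projection from the polynomial ring on \<open>V\<close> onto the quotient
  of the Stanley--Reisner ring of the link by the forms \<^term>\<open>ell q\<close>.\<close>

definition link_quotient_ideal ::
    "int ^ 'n::finite ^ 'd::finite \<Rightarrow> real ^ 'n \<Rightarrow> complex ^ 'n \<Rightarrow> (nat \<Rightarrow> 'n mpoly) \<Rightarrow>
     'n mpoly set" where
  "link_quotient_ideal A w v ell =
     ideal_sum (stanley_reisner_ideal (- nsupp v) (link_complex A w v))
       (ideal_gen_in (- nsupp v) (ell ` {1..CARD('d) - card (nsupp v)}))"

definition H_series ::
    "int ^ 'n::finite ^ 'd::finite \<Rightarrow> real ^ 'n \<Rightarrow> complex ^ 'n \<Rightarrow> (nat \<Rightarrow> 'n mpoly) \<Rightarrow>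
     int fps" where
  "H_series A w v ell = hilbert_series (- nsupp v) (link_quotient_ideal A w v ell)"

text \<open>The description is proper because the quotient is finite-dimensional.\<close>

definition H_poly ::
    "int ^ 'n::finite ^ 'd::finite \<Rightarrow> real ^ 'n \<Rightarrow> complex ^ 'n \<Rightarrow> (nat \<Rightarrow> 'n mpoly) \<Rightarrow>
     int poly" where
  "H_poly A w v ell = (THE p. fps_of_poly p = H_series A w v ell)"

definition fdeg ::
    "int ^ 'n::finite ^ 'd::finite \<Rightarrow> real ^ 'n \<Rightarrow> complex ^ 'n \<Rightarrow> (nat \<Rightarrow> 'n mpoly) \<Rightarrow> nat" where
  "fdeg A w v ell = degree (H_poly A w v ell)"

end

theory Submission
  imports Defs
begin

text \<open>
  The exponents \<open>g\<^sub>+\<close> and \<open>g\<^sub>-\<close> of an element of the reduced Groebner basis have disjoint supports,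
  so \<open>G\<^sup>(\<^sup>i\<^sup>)\<close> consists of the \<open>j\<close> with \<open>v\<^sub>j\<close> a natural number smaller than the \<open>j\<close>-th entry of
  \<open>g\<^sub>+\<close>. Truncating \<open>v\<close> outside a set and enlarging that set as long as possible yields a standard
  pair, whence the faces of \<open>\<Delta>\<^sub>w(v)\<close> are the sets that contain no \<open>G\<^sup>(\<^sup>i\<^sup>)\<close>. Therefore \<open>M\<^sub>\<theta>(v)\<close>
  extends the Stanley--Reisner ideal of the link. Substituting \<open>L\<^sub>p\<close> for the variables in \<open>I\<^sub>0\<close>
  identifies the quotient by \<open>Q\<^sub>v\<close> with the algebra defining the Hilbert series, and the pairing
  \<open>\<langle>\<phi>, f\<rangle> = (\<phi>(\<partial>)f)(0)\<close> makes the graded pieces of \<open>Q\<^sub>v\<^sup>\<bottom>\<close> dual to those of the quotient.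

  Since the columns of \<open>A\<close> indexed by the face of a standard pair are linearly independent, all
  monomials of degree above \<open>n\<close> lie in \<open>Q\<^sub>v\<close>. The constants lie in \<open>Q\<^sub>v\<^sup>\<bottom>\<close>: the polynomial of
  \<open>x\<^sup>u\<partial>\<^sup>u\<close> in the Euler operators, where \<open>u = g\<^sub>+\<close>, belongs to the fake indicial ideal, so it
  vanishes at \<open>v\<close>, which means that \<open>G\<^sup>(\<^sup>i\<^sup>)\<close> is nonempty.
\<close>

abbreviation "lookup \<equiv> Poly_Mapping.lookup"
abbreviation "keys \<equiv> Poly_Mapping.keys"
abbreviation "single \<equiv> Poly_Mapping.single"

section \<open>Exponents\<close>

lemma add_diff_expo: "lookup u \<le> lookup t \<Longrightarrow> u + (t - u) = t" for u t :: "'n expo"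
  by (intro poly_mapping_eqI) (simp add: lookup_add lookup_minus le_fun_def)

lemma expo_le_iff: "lookup u \<le> lookup t \<longleftrightarrow> (\<exists>c. t = u + c)" for u t :: "'n expo"
  by (metis add_diff_expo le_fun_def le_add1 lookup_add)

definition unit_expo :: "'n \<Rightarrow> 'n expo" where
  "unit_expo j = single j 1"

lemma lookup_unit_expo: "lookup (unit_expo j) k = (if k = j then 1 else 0)"
  by (simp add: unit_expo_def lookup_single when_def)

lemma unit_expo_add_diff: "lookup u j \<noteq> 0 \<Longrightarrow> unit_expo j + (u - unit_expo j) = u"
  by (rule add_diff_expo) (simp add: le_fun_def lookup_unit_expo)

lemma keys_unit_expo_add: "keys (unit_expo j + u) = insert j (keys u)"
proof -
  have "lookup (unit_expo j + u) k \<noteq> 0 \<longleftrightarrow> k = j \<or> lookup u k \<noteq> 0" for k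
    by (simp add: lookup_add lookup_unit_expo)
  then show ?thesis by (auto simp: in_keys_iff)
qed

lemma expo_degree_add: "expo_degree (u + u') = expo_degree u + expo_degree u'"
  by (simp add: expo_degree_def lookup_add sum.distrib)

lemma expo_degree_unit_expo: "expo_degree (unit_expo j) = 1"
  by (simp add: expo_degree_def lookup_unit_expo)

lemma expo_degree_sum_unit_expo: "expo_degree (\<Sum>j\<in>S. unit_expo j) = card S"
proof (induction S rule: infinite_finite_induct)
  case (insert j S)
  then show ?case by (simp add: expo_degree_add expo_degree_unit_expo)
qed (simp_all add: expo_degree_def)

lemma exists_lookup_gt_one:
  fixes u :: "'n::finite expo"
  assumes "CARD('n) < expo_degree u"
  shows "\<exists>j. 1 < lookup u j"
proof (rule ccontr)
  assume "\<not> ?thesis"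
  then have "expo_degree u \<le> (\<Sum>j\<in>(UNIV :: 'n set). 1)"
    unfolding expo_degree_def by (intro sum_mono) (simp add: not_less)
  with assms show False by simp
qed

lemma expo_induct [case_names zero unit_add]:
  fixes u :: "'n::finite expo"
  assumes "P 0" and unit_add: "\<And>j u. P u \<Longrightarrow> P (unit_expo j + u)"
  shows "P u"
proof (induction "expo_degree u" arbitrary: u rule: less_induct)
  case less
  show ?case
  proof (cases "u = 0")
    case False
    then obtain j where "lookup u j \<noteq> 0"
      by (metis lookup_zero poly_mapping_eqI)
    then have u_split: "u = unit_expo j + (u - unit_expo j)"
      by (rule unit_expo_add_diff[symmetric])
    then have "expo_degree u = 1 + expo_degree (u - unit_expo j)"
      by (metis expo_degree_add expo_degree_unit_expo)
    then have "P (u - unit_expo j)"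
      by (intro less) simp
    with u_split show ?thesis
      using unit_add by metis
  qed (use \<open>P 0\<close> in simp)
qed

lemma finite_expo_degree: "finite {u :: 'n::finite expo. expo_degree u = q}"
proof (rule finite_imageD)
  have "lookup u j \<le> expo_degree u" for u :: "'n expo" and j
    unfolding expo_degree_def by (rule member_le_sum) simp_all
  then have "lookup ` {u :: 'n expo. expo_degree u = q} \<subseteq> (UNIV \<rightarrow>\<^sub>E {..q})"
    by auto
  then show "finite (lookup ` {u :: 'n expo. expo_degree u = q})"
    by (rule finite_subset) (intro finite_PiE finite finite_atMost)
qed (simp add: inj_on_def lookup_inject)

definition restrict_expo :: "'n set \<Rightarrow> 'n expo \<Rightarrow> 'n expo" where
  "restrict_expo S u = Poly_Mapping.mapp (\<lambda>j k. if j \<in> S then k else 0) u"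

lemma lookup_restrict_expo: "lookup (restrict_expo S u) j = (if j \<in> S then lookup u j else 0)"
  by (simp add: restrict_expo_def lookup_mapp when_def in_keys_iff)

lemma keys_restrict_expo: "keys (restrict_expo S u) = S \<inter> keys u"
  by (auto simp: in_keys_iff lookup_restrict_expo split: if_splits)

section \<open>Polynomials\<close>

lemma poly_mapping_induct [case_names single add]:
  fixes p :: "'a \<Rightarrow>\<^sub>0 'b::comm_monoid_add"
  assumes single: "\<And>u c. P (single u c)" and add: "\<And>p q. P p \<Longrightarrow> P q \<Longrightarrow> P (p + q)"
  shows "P p"
proof -
  have "P (\<Sum>u\<in>S. single u (f u))" if "finite S" for S and f :: "'a \<Rightarrow> 'b"
    using that
  proof (induction S)
    case empty
    show ?case using single[of undefined 0] by simp
  next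
    case (insert x S)
    then show ?case by (simp add: add single)
  qed
  moreover have "p = (\<Sum>u\<in>keys p. single u (lookup p u))"
    by (rule poly_mapping_eqI) (simp add: lookup_sum lookup_single when_def in_keys_iff)
  ultimately show ?thesis by (metis finite_keys)
qed

lemma single_eq_pconst_mult_mon: "single u c = pconst c * mon u"
  by (simp add: pconst_def mon_def mult_single)

lemma mon_zero [simp]: "mon 0 = 1"
  by (simp add: mon_def)

lemma mon_add: "mon (u + u') = mon u * mon u'"
  by (simp add: mon_def mult_single)

lemma mon_sum: "mon (\<Sum>i\<in>I. f i) = (\<Prod>i\<in>I. mon (f i))"
  by (induction I rule: infinite_finite_induct) (simp_all add: mon_add)

lemma pvar_eq_mon: "pvar j = mon (unit_expo j)"
  by (simp add: pvar_def unit_expo_def)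

lemma prod_pvar: "(\<Prod>j\<in>S. pvar j) = mon (\<Sum>j\<in>S. unit_expo j)"
  by (simp add: pvar_eq_mon mon_sum)

lemma keys_mon [simp]: "keys (mon u) = {u}"
  by (simp add: mon_def)

lemma lookup_mon: "lookup (mon u) t = (if t = u then 1 else 0)"
  by (simp add: mon_def lookup_single when_def)

lemma mon_eq_iff [simp]: "mon u = mon u' \<longleftrightarrow> u = u'"
  by (metis keys_mon singleton_inject)

lemma cscale_single: "cscale a (single u c) = single u (a * c)"
  by (simp add: cscale_def pconst_def mult_single)

lemma lookup_cscale: "lookup (cscale a p) u = a * lookup p u"
  by (induction p rule: poly_mapping_induct)
     (simp_all add: cscale_single cpoly.scale_right_distrib lookup_add ring_distribs lookup_single
       when_def)

lemma sum_cscale_mon: "(\<Sum>u\<in>keys p. cscale (lookup p u) (mon u)) = p"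
  by (rule poly_mapping_eqI) (simp add: lookup_sum lookup_cscale lookup_mon in_keys_iff
    if_distrib[of "\<lambda>x. _ * x"] cong: if_cong)

lemma mpoly_induct [case_names const var add]:
  fixes p :: "'n::finite mpoly"
  assumes const: "\<And>c. P (pconst c)"
    and var: "\<And>j p. P p \<Longrightarrow> P (pvar j * p)"
    and add: "\<And>p q. P p \<Longrightarrow> P q \<Longrightarrow> P (p + q)"
  shows "P p"
proof (induction p rule: poly_mapping_induct)
  case (single u c)
  show ?case
  proof (induction u rule: expo_induct)
    case zero
    show ?case using const by (simp add: single_eq_pconst_mult_mon)
  next
    case (unit_add j u)
    have "single (unit_expo j + u) c = pvar j * single u c"
      by (simp add: single_eq_pconst_mult_mon mon_add pvar_eq_mon)
    then show ?case using var[OF unit_add] by simp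
  qed
qed (rule add)

section \<open>Ideals\<close>

interpretation ideal: module "(*) :: 'a::comm_ring_1 \<Rightarrow> 'a \<Rightarrow> 'a"
  rewrites "module.span (*) = ideal_gen"
  by unfold_locales (simp_all add: algebra_simps fun_eq_iff ideal_gen_def)

declare ideal.scale_scale [simp del] (* here it reads a * (b * x) = (a * b) * x *)

lemma subspace_ideal_gen: "cpoly.subspace (ideal_gen S)"
  by (rule cpoly.subspaceI)
     (simp_all add: cscale_def ideal.span_zero ideal.span_add ideal.span_scale)

lemma ideal_sum_ideal_gen: "ideal_sum (ideal_gen S) (ideal_gen T) = ideal_gen (S \<union> T)"
  by (simp add: ideal_sum_def ideal.span_Un)

lemma mult_diff_in_ideal_gen:
  assumes "p - p' \<in> ideal_gen S" and "q - q' \<in> ideal_gen S"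
  shows "p * q - p' * q' \<in> ideal_gen S"
proof -
  have "p * q - p' * q' = p * (q - q') + q' * (p - p')"
    by (simp add: algebra_simps)
  then show ?thesis
    using assms by (simp add: ideal.span_add ideal.span_scale)
qed

section \<open>Homomorphisms out of the polynomial ring\<close>

definition mpoly_hom :: "(complex \<Rightarrow> 'b::comm_ring_1) \<Rightarrow> ('n::finite \<Rightarrow> 'b) \<Rightarrow> 'n mpoly \<Rightarrow> 'b" where
  "mpoly_hom \<iota> s p = (\<Sum>u\<in>keys p. \<iota> (lookup p u) * (\<Prod>j\<in>UNIV. s j ^ lookup u j))"

locale coefficient_hom =
  fixes \<iota> :: "complex \<Rightarrow> 'b::comm_ring_1"
  assumes coeff_add: "\<iota> (x + y) = \<iota> x + \<iota> y"
    and coeff_mult: "\<iota> (x * y) = \<iota> x * \<iota> y"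
    and coeff_one: "\<iota> 1 = 1"
begin

sublocale coeff: additive \<iota>
  by unfold_locales (rule coeff_add)

sublocale hom: additive "mpoly_hom \<iota> s"
proof
  show "mpoly_hom \<iota> s (p + q) = mpoly_hom \<iota> s p + mpoly_hom \<iota> s q" for p q
    unfolding mpoly_hom_def
    by (rule setsum_keys_plus_distrib) (simp_all add: coeff.zero coeff_add ring_distribs)
qed

lemma hom_single: "mpoly_hom \<iota> s (single u a) = \<iota> a * (\<Prod>j\<in>UNIV. s j ^ lookup u j)"
  by (cases "a = 0") (simp_all add: mpoly_hom_def coeff.zero)

lemma hom_mult: "mpoly_hom \<iota> s (p * q) = mpoly_hom \<iota> s p * mpoly_hom \<iota> s q"
proof (induction p rule: poly_mapping_induct)
  case (single u a)
  show ?case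
    by (induction q rule: poly_mapping_induct)
       (simp_all add: hom_single hom.add mult_single coeff_mult lookup_add power_add prod.distrib
          ring_distribs mult_ac)
qed (simp add: hom.add ring_distribs)

lemma hom_pconst: "mpoly_hom \<iota> s (pconst a) = \<iota> a"
  by (simp add: pconst_def hom_single)

lemma hom_one: "mpoly_hom \<iota> s 1 = 1"
  using hom_single[of s 0 1] by (simp add: coeff_one)

lemma hom_pvar: "mpoly_hom \<iota> s (pvar j) = s j"
proof -
  have "(\<Prod>k\<in>UNIV. s k ^ lookup (unit_expo j) k) = (\<Prod>k\<in>UNIV. if k = j then s k else 1)"
    by (rule prod.cong) (simp_all add: lookup_unit_expo)
  then show ?thesis
    by (simp add: pvar_eq_mon mon_def hom_single coeff_one)
qed

end

interpretation eval: coefficient_hom "\<lambda>x. x"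
  by unfold_locales simp_all

interpretation subst: coefficient_hom pconst
  by unfold_locales (simp_all add: pconst_def single_add mult_single)

lemma eval_mpoly_eq_mpoly_hom: "eval_mpoly v = mpoly_hom (\<lambda>x. x) (\<lambda>j. v $ j)"
  by (simp add: fun_eq_iff eval_mpoly_def mpoly_hom_def)

section \<open>Polynomials in commuting operators\<close>

locale commuting_operators =
  fixes X :: "'n::finite \<Rightarrow> 'n mpoly \<Rightarrow> 'n mpoly"
  assumes scale: "X j (cscale c f) = cscale c (X j f)"
    and add: "X j (f + g) = X j f + X j g"
    and commute: "X j (X k f) = X k (X j f)"
begin

lemma funpow_commute: "(X j ^^ a) ((X k ^^ b) f) = (X k ^^ b) ((X j ^^ a) f)"
proof -
  have "(X j ^^ a) (X k g) = X k ((X j ^^ a) g)" for g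
    by (induction a) (simp_all add: commute)
  then show ?thesis
    by (induction b) simp_all
qed

lemma comp_fun_commute_funpow: "comp_fun_commute (\<lambda>j F. (X j ^^ lookup u j) \<circ> F)"
  by unfold_locales (simp add: fun_eq_iff funpow_commute)

lemma op_monomial_zero: "op_monomial X 0 = id"
proof -
  interpret comp_fun_commute "\<lambda>j F. (X j ^^ lookup 0 j) \<circ> F"
    by (rule comp_fun_commute_funpow)
  have "Finite_Set.fold (\<lambda>j F. (X j ^^ lookup 0 j) \<circ> F) id S = id" for S
  proof (induction S rule: infinite_finite_induct)
    case (insert j S)
    have "Finite_Set.fold (\<lambda>j F. (X j ^^ lookup 0 j) \<circ> F) id (insert j S)
        = (X j ^^ lookup 0 j) \<circ> Finite_Set.fold (\<lambda>j F. (X j ^^ lookup 0 j) \<circ> F) id S"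
      by (rule fold_insert) (use insert in simp_all)
    also have "\<dots> = id" unfolding insert.IH by simp
    finally show ?case .
  qed simp_all
  then show ?thesis by (simp add: op_monomial_def)
qed

lemma op_monomial_unit_add: "op_monomial X (unit_expo j + u) = X j \<circ> op_monomial X u"
proof -
  define F :: "'n expo \<Rightarrow> 'n \<Rightarrow> ('n mpoly \<Rightarrow> 'n mpoly) \<Rightarrow> 'n mpoly \<Rightarrow> 'n mpoly"
    where "F u = (\<lambda>k G. (X k ^^ lookup u k) \<circ> G)" for u
  have commute_F: "comp_fun_commute (F u)" for u
    unfolding F_def by (rule comp_fun_commute_funpow)
  have fold_split: "op_monomial X u = F u j (Finite_Set.fold (F u) id (UNIV - {j}))" for u
  proof -
    interpret comp_fun_commute "F u" by (rule commute_F)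
    show ?thesis using fold_rec[of UNIV j] by (simp add: op_monomial_def F_def)
  qed
  have "Finite_Set.fold (F (unit_expo j + u)) id (UNIV - {j})
      = Finite_Set.fold (F u) id (UNIV - {j})"
    by (rule Finite_Set.fold_cong[OF commute_F[unfolded comp_fun_commute_def']
          commute_F[unfolded comp_fun_commute_def']])
       (simp_all add: F_def lookup_add lookup_unit_expo)
  then show ?thesis
    unfolding fold_split by (simp add: F_def lookup_add lookup_unit_expo comp_assoc)
qed

lemma op_subst_single: "op_subst X (single u a) f = cscale a (op_monomial X u f)"
  by (cases "a = 0") (simp_all add: op_subst_def)

lemma op_subst_add: "op_subst X (p + q) f = op_subst X p f + op_subst X q f"
  unfolding op_subst_def
  by (rule setsum_keys_plus_distrib) (simp_all add: cpoly.scale_left_distrib)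

lemma op_subst_pconst: "op_subst X (pconst c) f = cscale c f"
  by (simp add: pconst_def op_subst_single op_monomial_zero)

lemma op_subst_one: "op_subst X 1 f = f"
  using op_subst_pconst[of 1 f] by (simp add: pconst_def)

lemma op_subst_pconst_mult: "op_subst X (pconst c * p) f = cscale c (op_subst X p f)"
  by (induction p rule: poly_mapping_induct)
     (simp_all add: pconst_def mult_single op_subst_single op_subst_add ring_distribs
       cpoly.scale_right_distrib)

lemma op_subst_pvar_mult: "op_subst X (pvar j * p) f = X j (op_subst X p f)"
  by (induction p rule: poly_mapping_induct)
     (simp_all add: pvar_eq_mon mon_def mult_single op_subst_single op_monomial_unit_add scale
       op_subst_add ring_distribs add)

end

lemma pderivative_single:
  "pderivative j (single u c) = single (u - unit_expo j) (c * of_nat (lookup u j))"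
  by (cases "c = 0") (simp_all add: pderivative_def unit_expo_def)

lemma pderivative_add: "pderivative j (f + g) = pderivative j f + pderivative j g"
  unfolding pderivative_def
  by (rule setsum_keys_plus_distrib) (simp_all add: single_add ring_distribs)

interpretation pderiv: commuting_operators "pderivative :: 'n::finite \<Rightarrow> 'n mpoly \<Rightarrow> 'n mpoly"
proof
  fix j k :: 'n and c and f :: "'n mpoly"
  show "pderivative j (cscale c f) = cscale c (pderivative j f)"
    by (induction f rule: poly_mapping_induct)
       (simp_all add: cscale_single pderivative_single pderivative_add cpoly.scale_right_distrib
         mult.assoc)
  show "pderivative j (pderivative k f) = pderivative k (pderivative j f)"
  proof (induction f rule: poly_mapping_induct)
    case (single u c)
    have "u - unit_expo k - unit_expo j = u - unit_expo j - unit_expo k"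
      by (simp add: diff_diff_add add.commute)
    then show ?case
      by (cases "j = k") (simp_all add: pderivative_single lookup_minus lookup_unit_expo mult_ac)
  qed (simp add: pderivative_add)
qed (rule pderivative_add)

lemma euler_op_single: "euler_op j (single u c) = single u (c * of_nat (lookup u j))"
  by (cases "lookup u j = 0")
     (simp_all add: euler_op_def pderivative_single pvar_eq_mon mon_def mult_single
       unit_expo_add_diff)

lemma euler_op_add: "euler_op j (f + g) = euler_op j f + euler_op j g"
  by (simp add: euler_op_def pderivative_add ring_distribs)

interpretation euler: commuting_operators "euler_op :: 'n::finite \<Rightarrow> 'n mpoly \<Rightarrow> 'n mpoly"
proof
  fix j k :: 'n and c and f :: "'n mpoly"
  show "euler_op j (cscale c f) = cscale c (euler_op j f)"
    unfolding euler_op_def pderiv.scale by (simp add: cscale_def mult.left_commute)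
  show "euler_op j (euler_op k f) = euler_op k (euler_op j f)"
    by (induction f rule: poly_mapping_induct)
       (simp_all add: euler_op_single euler_op_add mult_ac)
qed (rule euler_op_add)

lemma euler_op_mon_mult:
  "euler_op j (mon u * f) = cscale (of_nat (lookup u j)) (mon u * f) + mon u * euler_op j f"
proof (induction f rule: poly_mapping_induct)
  case (single t c)
  show ?case
    by (simp add: mon_def mult_single euler_op_single cscale_single lookup_add ring_distribs
        single_add mult.commute add.commute)
qed (simp add: euler_op_add ring_distribs cpoly.scale_right_distrib)

section \<open>Monomials in the fake indicial ideal\<close>

definition falling_poly :: "'n::finite expo \<Rightarrow> 'n mpoly" where
  "falling_poly u = (\<Prod>j\<in>UNIV. \<Prod>k<lookup u j. pvar j - pconst (of_nat k))"

lemma falling_poly_unit_add: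
  "falling_poly (unit_expo j + u) = (pvar j - pconst (of_nat (lookup u j))) * falling_poly u"
proof -
  have "falling_poly t = (\<Prod>k<lookup t j. pvar j - pconst (of_nat k)) *
      (\<Prod>i\<in>UNIV - {j}. \<Prod>k<lookup t i. pvar i - pconst (of_nat k))" for t :: "'a expo"
    unfolding falling_poly_def by (rule prod.remove) simp_all
  moreover have "(\<Prod>i\<in>UNIV - {j}. \<Prod>k<lookup (unit_expo j + u) i. pvar i - pconst (of_nat k))
      = (\<Prod>i\<in>UNIV - {j}. \<Prod>k<lookup u i. pvar i - pconst (of_nat k) :: 'a mpoly)"
    by (rule prod.cong) (simp_all add: lookup_add lookup_unit_expo)
  ultimately show ?thesis
    by (simp add: lookup_add lookup_unit_expo mult_ac)
qed

lemma eval_falling_poly_eq_0_iff: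
  "eval_mpoly v (falling_poly u) = 0 \<longleftrightarrow> (\<exists>j. \<exists>k<lookup u j. v $ j = of_nat k)"
proof (induction u rule: expo_induct)
  case zero
  show ?case by (simp add: falling_poly_def eval_mpoly_eq_mpoly_hom eval.hom_one)
next
  case (unit_add i u)
  have "eval_mpoly v (falling_poly (unit_expo i + u))
      = (v $ i - of_nat (lookup u i)) * eval_mpoly v (falling_poly u)"
    by (simp add: falling_poly_unit_add eval_mpoly_eq_mpoly_hom eval.hom_mult eval.hom.diff
        eval.hom_pvar eval.hom_pconst)
  then show ?case
    using unit_add by (auto simp: lookup_add lookup_unit_expo less_Suc_eq)
qed

lemma op_subst_falling_poly:
  "op_subst euler_op (falling_poly u) f = mon u * op_subst pderivative (mon u) f"
proof (induction u rule: expo_induct)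
  case zero
  show ?case by (simp add: falling_poly_def euler.op_subst_one pderiv.op_subst_one)
next
  case (unit_add j u)
  let ?g = "op_subst pderivative (mon u) f"
  have "op_subst euler_op (falling_poly (unit_expo j + u)) f
      = op_subst euler_op
          (pvar j * falling_poly u + pconst (- of_nat (lookup u j)) * falling_poly u) f"
    by (simp add: falling_poly_unit_add subst.coeff.minus ring_distribs)
  also have "\<dots> = euler_op j (mon u * ?g) - cscale (of_nat (lookup u j)) (mon u * ?g)"
    by (simp add: euler.op_subst_add euler.op_subst_pvar_mult euler.op_subst_pconst_mult unit_add)
  also have "\<dots> = mon u * euler_op j ?g"
    by (simp add: euler_op_mon_mult)
  also have "\<dots> = mon (unit_expo j + u) * op_subst pderivative (mon (unit_expo j + u)) f"
    by (simp add: euler_op_def mon_add pderiv.op_subst_pvar_mult mult.assoc mult.left_commute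
        flip: pvar_eq_mon)
  finally show ?case .
qed

lemma mon_mult_in_weyl_algebra: "(\<lambda>f. mon u * f) \<in> weyl_algebra" for u :: "'n::finite expo"
proof (induction u rule: expo_induct)
  case zero
  have "cscale 1 = (\<lambda>f :: 'n mpoly. mon 0 * f)"
    by (simp add: fun_eq_iff)
  then show ?case using weyl_algebra.const[of 1] by metis
next
  case (unit_add j u)
  from weyl_algebra.mult[OF weyl_algebra.var[of j] unit_add] show ?case
    by (simp add: o_def mon_add pvar_eq_mon mult.assoc)
qed

lemma falling_poly_in_fake_indicial_ideal:
  assumes "mon u \<in> initial_ideal w (toric_ideal A)"
  shows "falling_poly u \<in> fake_indicial_ideal A \<beta> w"
proof -
  have "op_subst euler_op (falling_poly u) =
      (\<lambda>f. \<Sum>i<1::nat. mon u * op_subst pderivative (mon u) f)"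
    by (simp add: fun_eq_iff op_subst_falling_poly)
  then have "op_subst euler_op (falling_poly u)
      \<in> weyl_left_ideal (op_subst pderivative ` initial_ideal w (toric_ideal A))"
    unfolding weyl_left_ideal_def using mon_mult_in_weyl_algebra[of u] assms
    by (intro CollectI exI[of _ "1::nat"] exI[of _ "\<lambda>_ f. mon u * f"]
        exI[of _ "\<lambda>_. op_subst pderivative (mon u)"]) simp
  then show ?thesis
    unfolding fake_indicial_ideal_def ideal_sum_def using ideal.span_zero
    by (intro CollectI exI[of _ "falling_poly u"] exI[of _ 0]) simp
qed

section \<open>Homogeneous components\<close>

lemma subspace_homogeneous_part: "cpoly.subspace (homogeneous_part q)"
proof (rule cpoly.subspaceI)
  fix p r :: "'n::finite mpoly" and c
  assume p_homogeneous: "p \<in> homogeneous_part q"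
  then show "cscale c p \<in> homogeneous_part q"
    by (auto simp: homogeneous_part_def in_keys_iff lookup_cscale)
  assume "r \<in> homogeneous_part q"
  with p_homogeneous show "p + r \<in> homogeneous_part q"
    using keys_add[of p r] by (auto simp: homogeneous_part_def)
qed (simp add: homogeneous_part_def)

lemma pconst_in_homogeneous_part: "pconst c \<in> homogeneous_part 0"
  by (auto simp: homogeneous_part_def pconst_def expo_degree_def)

lemma one_in_homogeneous_part: "1 \<in> homogeneous_part 0"
  by (simp add: homogeneous_part_def expo_degree_def)

lemma single_in_homogeneous_part: "single u c \<in> homogeneous_part (expo_degree u)"
  by (simp add: homogeneous_part_def)

lemma mon_in_homogeneous_part: "mon u \<in> homogeneous_part (expo_degree u)"
  unfolding mon_def by (rule single_in_homogeneous_part)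

lemma pvar_in_homogeneous_part: "pvar j \<in> homogeneous_part 1"
  using mon_in_homogeneous_part[of "unit_expo j"] by (simp add: pvar_eq_mon expo_degree_unit_expo)

lemma mult_in_homogeneous_part:
  "p \<in> homogeneous_part a \<Longrightarrow> r \<in> homogeneous_part b \<Longrightarrow> p * r \<in> homogeneous_part (a + b)"
  using keys_mult[of p r] by (fastforce simp: homogeneous_part_def expo_degree_add)

lemma linear_form_in_homogeneous_part:
  assumes "linear_form_in V p"
  shows "p \<in> homogeneous_part 1"
proof -
  obtain c where p_eq: "p = (\<Sum>j\<in>V. pconst (c j) * pvar j)"
    using assms unfolding linear_form_in_def ..
  have "pconst (c j) * pvar j \<in> homogeneous_part 1" for j
    using mult_in_homogeneous_part[OF pconst_in_homogeneous_part pvar_in_homogeneous_part] by simp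
  then show ?thesis
    unfolding p_eq by (intro cpoly.subspace_sum subspace_homogeneous_part)
qed

lemma homogeneous_part_subset_span:
  "homogeneous_part q \<subseteq> cpoly.span (mon ` {u :: 'n::finite expo. expo_degree u = q})"
proof
  fix p :: "'n mpoly" assume "p \<in> homogeneous_part q"
  then have "(\<Sum>u\<in>keys p. cscale (lookup p u) (mon u)) \<in> cpoly.span (mon ` {u. expo_degree u = q})"
    by (intro cpoly.span_sum cpoly.span_scale cpoly.span_base) (auto simp: homogeneous_part_def)
  then show "p \<in> cpoly.span (mon ` {u. expo_degree u = q})"
    by (simp add: sum_cscale_mon)
qed

definition homogeneous_component :: "nat \<Rightarrow> 'n::finite mpoly \<Rightarrow> 'n mpoly" where
  "homogeneous_component q p = (\<Sum>u\<in>{u \<in> keys p. expo_degree u = q}. single u (lookup p u))"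

lemma lookup_homogeneous_component:
  "lookup (homogeneous_component q p) u = (if expo_degree u = q then lookup p u else 0)"
  by (auto simp: homogeneous_component_def lookup_sum lookup_single when_def in_keys_iff)

interpretation homogeneous_component: additive "homogeneous_component q"
  by unfold_locales (rule poly_mapping_eqI, simp add: lookup_homogeneous_component lookup_add)

lemma homogeneous_component_single:
  "homogeneous_component q (single u c) = (if expo_degree u = q then single u c else 0)"
  by (rule poly_mapping_eqI) (simp add: lookup_homogeneous_component lookup_single when_def)

lemma homogeneous_component_cscale:
  "homogeneous_component q (cscale c p) = cscale c (homogeneous_component q p)"
  by (rule poly_mapping_eqI) (simp add: lookup_homogeneous_component lookup_cscale)

lemma homogeneous_component_in_part: "homogeneous_component q p \<in> homogeneous_part q"
  by (auto simp: homogeneous_part_def in_keys_iff lookup_homogeneous_component split: if_splits)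

lemma homogeneous_component_of_part:
  "p \<in> homogeneous_part d \<Longrightarrow> homogeneous_component q p = (if q = d then p else 0)"
  by (rule poly_mapping_eqI)
     (auto simp: lookup_homogeneous_component homogeneous_part_def in_keys_iff)

lemma homogeneous_component_mult:
  assumes "s \<in> homogeneous_part d"
  shows "homogeneous_component q (r * s) =
    (if d \<le> q then homogeneous_component (q - d) r * s else 0)"
proof (induction r rule: poly_mapping_induct)
  case (single u c)
  have "single u c * s \<in> homogeneous_part (expo_degree u + d)"
    by (rule mult_in_homogeneous_part[OF single_in_homogeneous_part assms])
  from homogeneous_component_of_part[OF this, of q] show ?case
    by (auto simp: homogeneous_component_single)
qed (simp add: ring_distribs homogeneous_component.add)

lemma sum_homogeneous_components:
  assumes "\<And>q. N < q \<Longrightarrow> homogeneous_component q p = 0"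
  shows "(\<Sum>q\<le>N. homogeneous_component q p) = p"
proof (rule poly_mapping_eqI)
  fix u
  have "lookup p u = 0" if "N < expo_degree u"
    using assms[OF that] lookup_homogeneous_component[of "expo_degree u" p u] by simp
  then show "lookup (\<Sum>q\<le>N. homogeneous_component q p) u = lookup p u"
    by (auto simp: lookup_sum lookup_homogeneous_component not_le)
qed

lemma homogeneous_component_in_ideal_gen:
  assumes homogeneous: "S \<subseteq> (\<Union>d. homogeneous_part d)" and p_in_ideal: "p \<in> ideal_gen S"
  shows "homogeneous_component q p \<in> ideal_gen S"
  using p_in_ideal
proof (induction rule: ideal.span_induct_alt)
  case (step r s p)
  obtain d where s_homogeneous: "s \<in> homogeneous_part d" using homogeneous step.hyps(1) by blast
  have "homogeneous_component q (r * s) \<in> ideal_gen S"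
    using step.hyps(1)
    by (simp add: homogeneous_component_mult[OF s_homogeneous] ideal.span_zero ideal.span_scale
        ideal.span_base)
  then show ?case using step.IH by (simp add: homogeneous_component.add ideal.span_add)
qed (simp add: homogeneous_component.zero ideal.span_zero)

section \<open>The apolarity pairing\<close>

definition expo_fact :: "'n::finite expo \<Rightarrow> complex" where
  "expo_fact u = (\<Prod>j\<in>UNIV. fact (lookup u j))"

lemma expo_fact_nonzero: "expo_fact u \<noteq> 0"
  by (simp add: expo_fact_def)

lemma expo_fact_unit_add:
  "expo_fact (unit_expo j + u) = of_nat (Suc (lookup u j)) * expo_fact u"
proof -
  have "expo_fact (unit_expo j + u) = (\<Prod>k\<in>UNIV. (if k = j then of_nat (Suc (lookup u j)) else 1) *
      fact (lookup u k))"
    unfolding expo_fact_def by (rule prod.cong) (simp_all add: lookup_add lookup_unit_expo)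
  then show ?thesis
    by (simp add: expo_fact_def prod.distrib)
qed

text \<open>The value \<open>\<langle>\<phi>, f\<rangle> = (\<phi>(\<partial>)f)(0)\<close>, in terms of coefficients.\<close>

definition apolar :: "'n::finite mpoly \<Rightarrow> 'n mpoly \<Rightarrow> complex" where
  "apolar \<phi> f = (\<Sum>u\<in>keys f. lookup \<phi> u * lookup f u * expo_fact u)"

interpretation apolar_left: additive "\<lambda>\<phi>. apolar \<phi> f"
  by unfold_locales (simp add: apolar_def lookup_add ring_distribs sum.distrib)

interpretation apolar_right: additive "apolar \<phi>"
  by unfold_locales
     (unfold apolar_def, rule setsum_keys_plus_distrib, simp_all add: ring_distribs)

lemma apolar_single: "apolar \<phi> (single u c) = lookup \<phi> u * c * expo_fact u"
  by (cases "c = 0") (simp_all add: apolar_def)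

lemma apolar_cscale_left: "apolar (cscale c \<phi>) f = c * apolar \<phi> f"
  by (simp add: apolar_def lookup_cscale sum_distrib_left mult.assoc)

lemma apolar_cscale_right: "apolar \<phi> (cscale c f) = c * apolar \<phi> f"
  by (induction f rule: poly_mapping_induct)
     (simp_all add: cscale_single apolar_single apolar_right.add cpoly.scale_right_distrib
       ring_distribs)

lemma apolar_mon_left: "apolar (mon u) f = lookup f u * expo_fact u"
  by (induction f rule: poly_mapping_induct)
     (simp_all add: apolar_single apolar_right.add lookup_add lookup_mon lookup_single
       ring_distribs)

lemma apolar_one_right: "apolar \<phi> 1 = lookup \<phi> 0"
  by (simp add: apolar_def expo_fact_def)

lemma apolar_eqI:
  assumes "\<And>\<phi>. apolar \<phi> f = apolar \<phi> g"
  shows "f = g"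
  using assms[of "mon _"] by (intro poly_mapping_eqI) (simp add: apolar_mon_left expo_fact_nonzero)

lemma apolar_homogeneous_component:
  "apolar \<phi> (homogeneous_component q f) = apolar (homogeneous_component q \<phi>) f"
  by (induction f rule: poly_mapping_induct)
     (simp_all add: homogeneous_component.add apolar_right.add apolar_single
       lookup_homogeneous_component homogeneous_component_single apolar_right.zero)

lemma apolar_component_left:
  "f \<in> homogeneous_part q \<Longrightarrow> apolar (homogeneous_component q \<phi>) f = apolar \<phi> f"
  by (simp add: homogeneous_component_of_part flip: apolar_homogeneous_component)

lemma apolar_pvar_mult: "apolar (pvar j * \<phi>) f = apolar \<phi> (pderivative j f)"
proof (induction f rule: poly_mapping_induct)
  case (single u c)
  show ?case
  proof (induction \<phi> rule: poly_mapping_induct)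
    case (single t a)
    show ?case
    proof (cases "lookup u j = 0")
      case True
      then have "u \<noteq> unit_expo j + t"
        by (auto simp: lookup_add lookup_unit_expo)
      with True show ?thesis
        by (auto simp: pderivative_single apolar_single apolar_right.zero pvar_eq_mon mon_def
            mult_single lookup_single when_def)
    next
      case False
      then obtain u' where "u = unit_expo j + u'"
        by (metis unit_expo_add_diff)
      then show ?thesis
        by (simp add: pderivative_single apolar_single pvar_eq_mon mon_def mult_single
            lookup_single when_def expo_fact_unit_add lookup_add lookup_unit_expo)
    qed
  qed (simp add: apolar_left.add ring_distribs)
qed (simp add: apolar_right.add pderivative_add)

lemma apolar_mult: "apolar (\<psi> * \<phi>) f = apolar \<psi> (op_subst pderivative \<phi> f)"
proof (induction \<phi> arbitrary: \<psi> rule: mpoly_induct)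
  case (const c)
  then show ?case
    by (simp add: pderiv.op_subst_pconst apolar_cscale_right mult.commute[of \<psi>]
        flip: cscale_def apolar_cscale_left)
next
  case (var j \<phi>)
  have "apolar (\<psi> * (pvar j * \<phi>)) f = apolar ((pvar j * \<psi>) * \<phi>) f"
    by (simp add: mult_ac)
  then show ?case
    by (simp add: var apolar_pvar_mult pderiv.op_subst_pvar_mult)
qed (simp add: ring_distribs apolar_left.add apolar_right.add pderiv.op_subst_add)

lemma perp_ideal_gen_iff: "f \<in> perp (ideal_gen S) \<longleftrightarrow> (\<forall>\<phi>\<in>ideal_gen S. apolar \<phi> f = 0)"
proof
  assume f_perp: "f \<in> perp (ideal_gen S)"
  show "\<forall>\<phi>\<in>ideal_gen S. apolar \<phi> f = 0"
  proof
    fix \<phi> assume "\<phi> \<in> ideal_gen S"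
    then have "op_subst pderivative \<phi> f = 0" using f_perp by (simp add: perp_def)
    then show "apolar \<phi> f = 0"
      using apolar_mult[of 1 \<phi> f] by (simp add: apolar_right.zero)
  qed
next
  assume orthogonal: "\<forall>\<phi>\<in>ideal_gen S. apolar \<phi> f = 0"
  have "op_subst pderivative \<phi> f = 0" if "\<phi> \<in> ideal_gen S" for \<phi>
  proof (rule apolar_eqI)
    show "apolar \<psi> (op_subst pderivative \<phi> f) = apolar \<psi> 0" for \<psi>
      using orthogonal ideal.span_scale[OF that, of \<psi>]
      by (simp add: apolar_right.zero flip: apolar_mult)
  qed
  then show "f \<in> perp (ideal_gen S)" by (simp add: perp_def)
qed

lemma subspace_perp: "cpoly.subspace (perp (ideal_gen S))"
  by (rule cpoly.subspaceI)
     (auto simp: perp_ideal_gen_iff apolar_right.zero apolar_right.add apolar_cscale_right)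

lemma homogeneous_component_in_perp:
  assumes "S \<subseteq> (\<Union>d. homogeneous_part d)" and "f \<in> perp (ideal_gen S)"
  shows "homogeneous_component q f \<in> perp (ideal_gen S)"
  using assms by (simp add: perp_ideal_gen_iff apolar_homogeneous_component
      homogeneous_component_in_ideal_gen)

lemma homogeneous_component_perp_eq_0:
  assumes "homogeneous_part q \<subseteq> ideal_gen S" and "f \<in> perp (ideal_gen S)"
  shows "homogeneous_component q f = 0"
proof (rule apolar_eqI)
  fix \<phi>
  have "homogeneous_component q \<phi> \<in> ideal_gen S"
    using assms(1) homogeneous_component_in_part by blast
  then show "apolar \<phi> (homogeneous_component q f) = apolar \<phi> 0"
    using assms(2) by (simp add: apolar_homogeneous_component perp_ideal_gen_iff apolar_right.zero)
qed

lemma one_in_perp_ideal_gen: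
  assumes "\<And>s. s \<in> S \<Longrightarrow> \<exists>d>0. s \<in> homogeneous_part d"
  shows "1 \<in> perp (ideal_gen S)"
proof -
  have "homogeneous_component 0 \<phi> = 0" if "\<phi> \<in> ideal_gen S" for \<phi>
    using that
  proof (induction rule: ideal.span_induct_alt)
    case (step r s \<phi>)
    obtain d where s_homogeneous: "d > 0" "s \<in> homogeneous_part d"
      using assms[OF step.hyps(1)] by blast
    then show ?case
      using step.IH by (simp add: homogeneous_component.add homogeneous_component_mult)
  qed (simp add: homogeneous_component.zero)
  then have "lookup \<phi> 0 = 0" if "\<phi> \<in> ideal_gen S" for \<phi>
    using that lookup_homogeneous_component[of 0 \<phi> 0] by (simp add: expo_degree_def)
  then show ?thesis by (simp add: perp_ideal_gen_iff apolar_one_right)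
qed

section \<open>Bases of quotient spaces\<close>

abbreviation lin_comb :: "('n mpoly \<Rightarrow> complex) \<Rightarrow> 'n mpoly set \<Rightarrow> 'n mpoly" where
  "lin_comb c B \<equiv> (\<Sum>b\<in>B. cscale (c b) b)"

definition quot_basis :: "'n mpoly set \<Rightarrow> 'n mpoly set \<Rightarrow> 'n mpoly set \<Rightarrow> bool" where
  "quot_basis W U B \<longleftrightarrow> finite B \<and> B \<subseteq> W \<and>
     (\<forall>p\<in>W. \<exists>!c. (\<forall>b. b \<notin> B \<longrightarrow> c b = 0) \<and> p - lin_comb c B \<in> U)"

lemma lin_comb_delta:
  assumes "finite B" "b \<in> B"
  shows "lin_comb (\<lambda>b'. if b' = b then 1 else 0) B = b"
  using assms by (simp add: if_distrib[of "\<lambda>c. cscale c _"] cong: if_cong)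

lemma quot_basis_spans:
  assumes "quot_basis W U B" and "p \<in> W"
  shows "\<exists>c. p - lin_comb c B \<in> U"
  using assms unfolding quot_basis_def by blast

lemma quot_basis_independent:
  assumes subspace_W: "cpoly.subspace W" and subspace_U: "cpoly.subspace U"
    and basis: "quot_basis W U B"
    and comb_in_U: "lin_comb c B \<in> U" and b_in_B: "b \<in> B"
  shows "c b = 0"
proof -
  define coords where "coords c' \<longleftrightarrow> (\<forall>b. b \<notin> B \<longrightarrow> c' b = 0) \<and>
    lin_comb c B - lin_comb c' B \<in> U" for c'
  let ?c = "\<lambda>b. if b \<in> B then c b else 0"
  have "lin_comb c B \<in> W"
    using basis
    by (intro cpoly.subspace_sum cpoly.subspace_scale subspace_W) (auto simp: quot_basis_def)
  then have "\<exists>\<^sub>\<le>\<^sub>1c'. coords c'"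
    using basis unfolding quot_basis_def coords_def ex1_iff_ex_Uniq by blast
  moreover have "coords ?c" "coords (\<lambda>_. 0)"
    using comb_in_U cpoly.subspace_0[OF subspace_U] by (simp_all add: coords_def)
  ultimately have "?c = (\<lambda>_. 0)" by (rule Uniq_D[where P = coords])
  from fun_cong[OF this, of b] b_in_B show ?thesis by simp
qed

lemma quot_basisI:
  assumes subspace_U: "cpoly.subspace U" and B_subset: "finite B" "B \<subseteq> W"
    and spans: "\<And>p. p \<in> W \<Longrightarrow> \<exists>c. p - lin_comb c B \<in> U"
    and independent: "\<And>c b. lin_comb c B \<in> U \<Longrightarrow> b \<in> B \<Longrightarrow> c b = 0"
  shows "quot_basis W U B"
  unfolding quot_basis_def
proof (intro conjI ballI B_subset)
  fix p assume "p \<in> W"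
  then obtain c where c_spans: "p - lin_comb c B \<in> U"
    using spans by blast
  show "\<exists>!c. (\<forall>b. b \<notin> B \<longrightarrow> c b = 0) \<and> p - lin_comb c B \<in> U"
  proof (rule ex1I[of _ "\<lambda>b. if b \<in> B then c b else 0"])
    fix c' assume c'_coords: "(\<forall>b. b \<notin> B \<longrightarrow> c' b = 0) \<and> p - lin_comb c' B \<in> U"
    have "lin_comb (\<lambda>b. c b - c' b) B = (p - lin_comb c' B) - (p - lin_comb c B)"
      by (simp add: cpoly.scale_left_diff_distrib sum_subtractf)
    also have "\<dots> \<in> U"
      by (rule cpoly.subspace_diff[OF subspace_U conjunct2[OF c'_coords] c_spans])
    finally have "c b - c' b = 0" if "b \<in> B" for b
      using that by (rule independent)
    then show "c' = (\<lambda>b. if b \<in> B then c b else 0)"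
      using c'_coords by (auto simp: fun_eq_iff)
  qed (use c_spans in simp)
qed

lemma quot_basis_exists:
  assumes F_spans: "finite F" "W \<subseteq> cpoly.span F" and subspace_W: "cpoly.subspace W"
    and subspace_U: "cpoly.subspace U"
  shows "\<exists>B. quot_basis W U B"
proof -
  obtain C where C_basis: "C \<subseteq> W \<inter> U" "cpoly.independent C" "W \<inter> U \<subseteq> cpoly.span C"
    by (rule cpoly.maximal_independent_subset)
  then obtain B where B_extends: "C \<subseteq> B" "B \<subseteq> W" "cpoly.independent B" "W \<subseteq> cpoly.span B"
    using cpoly.maximal_independent_subset_extend[of C W] by blast
  have finite_B: "finite B"
    using cpoly.independent_span_bound[OF F_spans(1) B_extends(3)] B_extends(2) F_spans(2) by blast
  then have finite_C: "finite C" using B_extends(1) finite_subset by blast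
  have comb_split: "lin_comb c B = lin_comb c (B - C) + lin_comb c C" for c
    by (rule sum.subset_diff[OF B_extends(1) finite_B])
  have "\<exists>c. p - lin_comb c (B - C) \<in> U" if p_in_W: "p \<in> W" for p
  proof -
    obtain c where "p = lin_comb c B"
      using p_in_W B_extends(4) cpoly.span_finite[OF finite_B] by blast
    then have "p - lin_comb c (B - C) = lin_comb c C"
      by (simp add: comb_split)
    also have "\<dots> \<in> U"
      using C_basis(1) by (intro cpoly.subspace_sum cpoly.subspace_scale subspace_U) blast
    finally show ?thesis by blast
  qed
  moreover have "c b = 0" if comb_in_U: "lin_comb c (B - C) \<in> U" and b_in_diff: "b \<in> B - C" for c b
  proof -
    have "lin_comb c (B - C) \<in> W"
      using B_extends(2) by (intro cpoly.subspace_sum cpoly.subspace_scale subspace_W) blast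
    then obtain r where r_comb: "lin_comb c (B - C) = lin_comb r C"
      using comb_in_U C_basis(3) cpoly.span_finite[OF finite_C] by blast
    have "lin_comb (\<lambda>b. if b \<in> C then - r b else c b) B = 0"
      unfolding comb_split using r_comb by (simp add: sum_negf)
    from cpoly.independentD[OF B_extends(3) finite_B order_refl this, of b] b_in_diff show ?thesis
      by simp
  qed
  ultimately have "quot_basis W U (B - C)"
    using finite_B B_extends(2) by (intro quot_basisI[OF subspace_U]) auto
  then show ?thesis ..
qed

lemma quot_basis_transfer:
  assumes subspace_W: "cpoly.subspace W" and subspace_U: "cpoly.subspace U"
    and subspace_U': "cpoly.subspace U'"
    and basis: "quot_basis W U B" and W_subset: "W \<subseteq> W'"
    and reduce: "\<And>p. p \<in> W' \<Longrightarrow> \<exists>p'\<in>W. p - p' \<in> U'"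
    and U_iff_U': "\<And>p. p \<in> W \<Longrightarrow> p \<in> U \<longleftrightarrow> p \<in> U'"
  shows "quot_basis W' U' B"
proof -
  have B_subset: "finite B" "B \<subseteq> W"
    using basis by (simp_all add: quot_basis_def)
  have comb_in_W: "lin_comb c B \<in> W" for c
    using B_subset subspace_W by (intro cpoly.subspace_sum cpoly.subspace_scale) auto
  show ?thesis
  proof (rule quot_basisI[OF subspace_U' B_subset(1)])
    show "B \<subseteq> W'" using B_subset(2) W_subset by simp
    show "\<exists>c. p - lin_comb c B \<in> U'" if p_in_W': "p \<in> W'" for p
    proof -
      obtain p' where p'_reduces: "p' \<in> W" "p - p' \<in> U'"
        using reduce[OF p_in_W'] by blast
      obtain c where "p' - lin_comb c B \<in> U"
        using quot_basis_spans[OF basis p'_reduces(1)] by blast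
      then have "p' - lin_comb c B \<in> U'"
        using U_iff_U' comb_in_W p'_reduces(1) subspace_W by (simp add: cpoly.subspace_diff)
      from cpoly.subspace_add[OF subspace_U' p'_reduces(2) this] show ?thesis by auto
    qed
    show "c b = 0" if "lin_comb c B \<in> U'" "b \<in> B" for c b
      using that U_iff_U'[OF comb_in_W]
      by (intro quot_basis_independent[OF subspace_W subspace_U basis]) simp_all
  qed
qed

lemma quot_dim_eqI:
  assumes "quot_basis W U B" and "\<And>B. quot_basis W U B \<Longrightarrow> card B = n"
  shows "quot_dim W U = n"
proof -
  have "quot_dim W U = (THE n. \<exists>B. quot_basis W U B \<and> card B = n)"
    unfolding quot_dim_def quot_basis_def by (rule arg_cong[where f = The]) (auto simp: fun_eq_iff)
  also have "\<dots> = n"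
    using assms by (intro the_equality) auto
  finally show ?thesis .
qed

section \<open>Graded pieces of the apolar space\<close>

definition dual_family :: "nat \<Rightarrow> 'n::finite mpoly set \<Rightarrow> 'n mpoly set \<Rightarrow> ('n mpoly \<Rightarrow> 'n mpoly) \<Rightarrow> bool"
  where "dual_family q U B g \<longleftrightarrow> (\<forall>b\<in>B. g b \<in> homogeneous_part q) \<and>
    (\<forall>\<phi>\<in>homogeneous_part q. \<phi> - lin_comb (\<lambda>b. apolar \<phi> (g b)) B \<in> U)"

lemma dual_familyD:
  assumes "dual_family q U B g"
  shows "b \<in> B \<Longrightarrow> g b \<in> homogeneous_part q"
    and "\<phi> \<in> homogeneous_part q \<Longrightarrow> \<phi> - lin_comb (\<lambda>b. apolar \<phi> (g b)) B \<in> U"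
  using assms by (auto simp: dual_family_def)

lemma dual_family_exists:
  fixes U :: "'n::finite mpoly set"
  assumes subspace_U: "cpoly.subspace U" and basis: "quot_basis (homogeneous_part q) U B"
  shows "\<exists>g. dual_family q U B g"
proof -
  define E where "E = {u :: 'n expo. expo_degree u = q}"
  have "\<exists>c. mon u - lin_comb c B \<in> U" if "u \<in> E" for u
    using that mon_in_homogeneous_part[of u] by (intro quot_basis_spans[OF basis]) (simp add: E_def)
  then obtain \<gamma> where mon_mod_U: "\<And>u. u \<in> E \<Longrightarrow> mon u - lin_comb (\<gamma> u) B \<in> U"
    by metis
  define g where "g b = (\<Sum>u\<in>E. single u (\<gamma> u b / expo_fact u))" for b
  have "g b \<in> homogeneous_part q" for b
    unfolding g_def
    by (intro cpoly.subspace_sum subspace_homogeneous_part) (simp add: homogeneous_part_def E_def)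
  moreover have "\<phi> - lin_comb (\<lambda>b. apolar \<phi> (g b)) B \<in> U"
    if \<phi>_homogeneous: "\<phi> \<in> homogeneous_part q" for \<phi>
  proof -
    have "keys \<phi> \<subseteq> E" using \<phi>_homogeneous by (auto simp: homogeneous_part_def E_def)
    then have apolar_g: "apolar \<phi> (g b) = (\<Sum>u\<in>keys \<phi>. lookup \<phi> u * \<gamma> u b)" for b
      unfolding g_def apolar_right.sum apolar_single
      by (intro sum.mono_neutral_cong_right)
         (auto simp: E_def finite_expo_degree expo_fact_nonzero in_keys_iff)
    have "\<phi> - lin_comb (\<lambda>b. apolar \<phi> (g b)) B
        = (\<Sum>u\<in>keys \<phi>. cscale (lookup \<phi> u) (mon u))
          - (\<Sum>b\<in>B. \<Sum>u\<in>keys \<phi>. cscale (lookup \<phi> u) (cscale (\<gamma> u b) b))"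
      by (simp add: sum_cscale_mon apolar_g cpoly.scale_sum_left)
    also have "\<dots> = (\<Sum>u\<in>keys \<phi>. cscale (lookup \<phi> u) (mon u - lin_comb (\<gamma> u) B))"
      by (subst sum.swap)
         (simp only: cpoly.scale_right_diff_distrib sum_subtractf cpoly.scale_sum_right)
    also have "\<dots> \<in> U"
      using mon_mod_U \<open>keys \<phi> \<subseteq> E\<close>
      by (intro cpoly.subspace_sum cpoly.subspace_scale subspace_U) blast
    finally show ?thesis .
  qed
  ultimately have "dual_family q U B g" by (simp add: dual_family_def)
  then show ?thesis by blast
qed

lemma independent_biorthogonal:
  assumes finite_B: "finite B"
    and biorthogonal: "\<And>b b'. b \<in> B \<Longrightarrow> b' \<in> B \<Longrightarrow> apolar b (g b') = (if b' = b then 1 else 0)"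
  shows "inj_on g B" and "cpoly.independent (g ` B)"
proof -
  show inj_g: "inj_on g B"
  proof (rule inj_onI)
    fix b b' assume b_in_B: "b \<in> B" "b' \<in> B" and g_eq: "g b = g b'"
    have "apolar b (g b') = 1" using biorthogonal[OF b_in_B(1) b_in_B(1)] unfolding g_eq by simp
    then show "b = b'" using biorthogonal[OF b_in_B] by (simp split: if_splits)
  qed
  show "cpoly.independent (g ` B)"
  proof (rule cpoly.independent_if_scalars_zero)
    fix c x assume comb_zero: "lin_comb c (g ` B) = 0" and "x \<in> g ` B"
    then obtain b where b_in_B: "b \<in> B" "x = g b" by blast
    have "0 = apolar b (\<Sum>b'\<in>B. cscale (c (g b')) (g b'))"
      using comb_zero by (simp add: sum.reindex[OF inj_g] apolar_right.zero)
    also have "\<dots> = (\<Sum>b'\<in>B. c (g b') * apolar b (g b'))"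
      by (simp add: apolar_right.sum apolar_cscale_right)
    also have "\<dots> = c x"
      using b_in_B finite_B by (simp add: biorthogonal if_distrib[of "\<lambda>x. _ * x"] cong: if_cong)
    finally show "c x = 0" ..
  qed (use finite_B in simp)
qed

lemma dual_family_biorthogonal:
  assumes homogeneous: "S \<subseteq> (\<Union>d. homogeneous_part d)"
    and basis: "quot_basis (homogeneous_part q) (ideal_gen S) B"
    and dual: "dual_family q (ideal_gen S) B g" and b_in_B: "b \<in> B"
  shows "\<phi> \<in> ideal_gen S \<Longrightarrow> apolar \<phi> (g b) = 0"
    and "b' \<in> B \<Longrightarrow> apolar b' (g b) = (if b = b' then 1 else 0)"
proof -
  have finite_B: "finite B" and B_homogeneous: "B \<subseteq> homogeneous_part q"
    and independent: "\<And>c b. lin_comb c B \<in> ideal_gen S \<Longrightarrow> b \<in> B \<Longrightarrow> c b = 0"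
    using basis quot_basis_independent[OF subspace_homogeneous_part subspace_ideal_gen basis]
    by (simp_all add: quot_basis_def)
  show "apolar \<phi> (g b) = 0" if \<phi>_in_ideal: "\<phi> \<in> ideal_gen S"
  proof -
    let ?\<phi> = "homogeneous_component q \<phi>"
    have "?\<phi> \<in> ideal_gen S" by (rule homogeneous_component_in_ideal_gen[OF homogeneous \<phi>_in_ideal])
    from ideal.span_diff[OF this dual_familyD(2)[OF dual homogeneous_component_in_part[of q \<phi>]]]
    have "lin_comb (\<lambda>b. apolar ?\<phi> (g b)) B \<in> ideal_gen S" by simp
    from independent[OF this b_in_B] show ?thesis
      by (simp add: apolar_component_left[OF dual_familyD(1)[OF dual b_in_B]])
  qed
  show "apolar b' (g b) = (if b = b' then 1 else 0)" if b'_in_B: "b' \<in> B"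
  proof -
    have "lin_comb (\<lambda>b. (if b = b' then 1 else 0) - apolar b' (g b)) B
        = b' - lin_comb (\<lambda>b. apolar b' (g b)) B"
      using lin_comb_delta[OF finite_B b'_in_B]
      by (simp only: cpoly.scale_left_diff_distrib sum_subtractf)
    also have "\<dots> \<in> ideal_gen S"
      using b'_in_B B_homogeneous by (intro dual_familyD(2)[OF dual]) blast
    finally have "(if b = b' then 1 else 0) - apolar b' (g b) = 0"
      by (rule independent[OF _ b_in_B])
    then show ?thesis by (simp only: right_minus_eq)
  qed
qed

lemma dual_family_expansion:
  fixes S :: "'n::finite mpoly set"
  assumes dual: "dual_family q (ideal_gen S) B g"
    and f_perp: "f \<in> perp (ideal_gen S)" "f \<in> homogeneous_part q"
  shows "f = (\<Sum>b\<in>B. cscale (apolar b f) (g b))"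
proof (rule apolar_eqI)
  fix \<phi> :: "'n mpoly"
  let ?f = "\<Sum>b\<in>B. cscale (apolar b f) (g b)"
  define \<psi> where "\<psi> = homogeneous_component q \<phi>"
  have "0 = apolar (\<psi> - lin_comb (\<lambda>b. apolar \<psi> (g b)) B) f"
    using f_perp(1) dual_familyD(2)[OF dual homogeneous_component_in_part, of \<phi>]
    by (simp add: perp_ideal_gen_iff \<psi>_def)
  then have "apolar \<psi> f = apolar \<psi> ?f"
    by (simp add: apolar_left.diff apolar_left.sum apolar_right.sum apolar_cscale_left
        apolar_cscale_right mult.commute)
  moreover have "?f \<in> homogeneous_part q"
    by (intro cpoly.subspace_sum cpoly.subspace_scale subspace_homogeneous_part
        dual_familyD(1)[OF dual])
  ultimately show "apolar \<phi> f = apolar \<phi> ?f"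
    using f_perp(2) by (simp add: \<psi>_def apolar_component_left)
qed

lemma dim_perp_eq_card_quot_basis:
  assumes homogeneous: "S \<subseteq> (\<Union>d. homogeneous_part d)"
    and basis: "quot_basis (homogeneous_part q) (ideal_gen S) B"
  shows "cpoly.dim (perp (ideal_gen S) \<inter> homogeneous_part q) = card B"
proof -
  let ?P = "perp (ideal_gen S) \<inter> homogeneous_part q"
  obtain g where dual: "dual_family q (ideal_gen S) B g"
    using dual_family_exists[OF subspace_ideal_gen basis] ..
  have biorthogonal: "apolar b (g b') = (if b' = b then 1 else 0)" if "b \<in> B" "b' \<in> B" for b b'
    using dual_family_biorthogonal(2)[OF homogeneous basis dual] that by blast
  have finite_B: "finite B" using basis by (simp add: quot_basis_def)
  have "g ` B \<subseteq> ?P"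
    using dual_familyD(1)[OF dual] dual_family_biorthogonal(1)[OF homogeneous basis dual]
    by (auto simp: perp_ideal_gen_iff)
  moreover have "f \<in> cpoly.span (g ` B)" if "f \<in> ?P" for f
  proof -
    have "(\<Sum>b\<in>B. cscale (apolar b f) (g b)) \<in> cpoly.span (g ` B)"
      by (intro cpoly.span_sum cpoly.span_scale cpoly.span_base imageI)
    then show ?thesis
      using dual_family_expansion[OF dual, of f] that by simp
  qed
  then have "?P \<subseteq> cpoly.span (g ` B)" by blast
  ultimately have "card (g ` B) = cpoly.dim ?P"
    using independent_biorthogonal(2)[OF finite_B biorthogonal] by (intro cpoly.basis_card_eq_dim)
  then show ?thesis
    using card_image[OF independent_biorthogonal(1)[OF finite_B biorthogonal]] by simp
qed

lemma dim_eq_0_iff: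
  assumes "finite F" "V \<subseteq> cpoly.span F"
  shows "cpoly.dim V = 0 \<longleftrightarrow> V \<subseteq> {0}"
proof
  assume dim_zero: "cpoly.dim V = 0"
  obtain B where B_basis: "B \<subseteq> V" "cpoly.independent B" "V \<subseteq> cpoly.span B" "card B = cpoly.dim V"
    by (rule cpoly.basis_exists)
  have "finite B"
    using cpoly.independent_span_bound[OF assms(1) B_basis(2)] B_basis(1) assms(2) by blast
  then show "V \<subseteq> {0}" using B_basis(3,4) dim_zero by simp
next
  assume "V \<subseteq> {0}"
  then show "cpoly.dim V = 0"
    using cpoly.dim_le_card[of V "{}"] by simp
qed

lemma homogeneous_part_Int:
  assumes "q \<noteq> q'"
  shows "homogeneous_part q \<inter> homogeneous_part q' = {0}"
proof -
  have "p = 0" if "p \<in> homogeneous_part q" "p \<in> homogeneous_part q'" for p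
    using homogeneous_component_of_part[OF that(1), of q]
      homogeneous_component_of_part[OF that(2), of q] assms by simp
  then show ?thesis
    using cpoly.subspace_0[OF subspace_homogeneous_part] by blast
qed

lemma finite_independent_homogeneous:
  assumes "B \<subseteq> homogeneous_part q" and "cpoly.independent B"
  shows "finite B"
proof -
  have "B \<subseteq> cpoly.span (mon ` {u. expo_degree u = q})"
    using assms(1) homogeneous_part_subset_span by blast
  from cpoly.independent_span_bound[OF _ assms(2) this] show ?thesis
    by (simp add: finite_expo_degree)
qed

lemma independent_homogeneous_disjoint:
  assumes "B \<subseteq> homogeneous_part q" "B' \<subseteq> homogeneous_part q'" "q \<noteq> q'"
    and "cpoly.independent B"
  shows "B \<inter> B' = {}"
proof -
  have "B \<inter> B' \<subseteq> {0}" using homogeneous_part_Int assms(1-3) by blast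
  moreover have "0 \<notin> B" using assms(4) cpoly.dependent_zero by blast
  ultimately show ?thesis by blast
qed

lemma independent_UN_homogeneous:
  assumes homogeneous: "\<And>q. B q \<subseteq> homogeneous_part q" and independent: "\<And>q. cpoly.independent (B q)"
  shows "cpoly.independent (\<Union>q\<in>I. B q)"
  unfolding cpoly.independent_explicit_module
proof (intro allI impI)
  fix T c x
  assume T_subset: "finite T" "T \<subseteq> (\<Union>q\<in>I. B q)" and comb_zero: "lin_comb c T = 0"
    and x_in_T: "x \<in> T"
  obtain q where x_in_B: "x \<in> B q" using T_subset(2) x_in_T by blast
  have "homogeneous_component q y = 0" if y_notin_B: "y \<in> T - B q" for y
  proof -
    obtain q' where y_in_B': "y \<in> B q'" using T_subset(2) y_notin_B by blast
    then have "q \<noteq> q'" using y_notin_B by blast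
    then show ?thesis using homogeneous_component_of_part[of y q' q] y_in_B' homogeneous by auto
  qed
  moreover have "homogeneous_component q y = y" if "y \<in> B q" for y
    using homogeneous_component_of_part[of y q q] homogeneous that by auto
  ultimately have "(\<Sum>y\<in>T. cscale (c y) (homogeneous_component q y)) = lin_comb c (T \<inter> B q)"
    using T_subset(1) by (intro sum.mono_neutral_cong_right) auto
  moreover have "(\<Sum>y\<in>T. cscale (c y) (homogeneous_component q y)) = 0"
    using arg_cong[OF comb_zero, of "homogeneous_component q"]
    by (simp add: homogeneous_component.sum homogeneous_component_cscale homogeneous_component.zero)
  ultimately have "lin_comb c (T \<inter> B q) = 0" by simp
  from cpoly.independentD[OF independent _ _ this, of q x] show "c x = 0"
    using T_subset(1) x_in_T x_in_B by simp
qed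

lemma dim_graded_subspace:
  assumes component: "\<And>f q. f \<in> P \<Longrightarrow> homogeneous_component q f \<in> P"
    and bounded: "\<And>f q. f \<in> P \<Longrightarrow> N < q \<Longrightarrow> homogeneous_component q f = 0"
  shows "cpoly.dim P = (\<Sum>q\<le>N. cpoly.dim (P \<inter> homogeneous_part q))"
proof -
  let ?P = "\<lambda>q. P \<inter> homogeneous_part q"
  have "\<exists>B \<subseteq> ?P q. cpoly.independent B \<and> ?P q \<subseteq> cpoly.span B \<and> card B = cpoly.dim (?P q)" for q
    using cpoly.basis_exists[of "?P q"] by metis
  then obtain B where B_subset: "\<And>q. B q \<subseteq> ?P q" and independent: "\<And>q. cpoly.independent (B q)"
    and B_spans: "\<And>q. ?P q \<subseteq> cpoly.span (B q)" and card_B: "\<And>q. card (B q) = cpoly.dim (?P q)"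
    by metis
  have B_homogeneous: "B q \<subseteq> homogeneous_part q" for q using B_subset by blast
  have "P \<subseteq> cpoly.span (\<Union>q\<le>N. B q)"
  proof
    fix f assume f_in_P: "f \<in> P"
    have "homogeneous_component q f \<in> cpoly.span (\<Union>q\<le>N. B q)" if "q \<le> N" for q
    proof -
      have "homogeneous_component q f \<in> cpoly.span (B q)"
        using component[OF f_in_P] homogeneous_component_in_part B_spans by blast
      moreover have "cpoly.span (B q) \<subseteq> cpoly.span (\<Union>q\<le>N. B q)"
        using that by (intro cpoly.span_mono) auto
      ultimately show ?thesis by blast
    qed
    then have "(\<Sum>q\<le>N. homogeneous_component q f) \<in> cpoly.span (\<Union>q\<le>N. B q)"
      by (intro cpoly.span_sum) simp
    then show "f \<in> cpoly.span (\<Union>q\<le>N. B q)"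
      using sum_homogeneous_components[of N f] bounded[OF f_in_P] by simp
  qed
  moreover have "(\<Union>q\<le>N. B q) \<subseteq> P" using B_subset by blast
  moreover have "cpoly.independent (\<Union>q\<le>N. B q)"
    by (rule independent_UN_homogeneous[OF B_homogeneous independent])
  ultimately have "cpoly.dim P = card (\<Union>q\<le>N. B q)"
    by (metis cpoly.basis_card_eq_dim)
  also have "\<dots> = (\<Sum>q\<le>N. card (B q))"
    using finite_independent_homogeneous[OF B_homogeneous independent]
      independent_homogeneous_disjoint[OF B_homogeneous B_homogeneous _ independent]
    by (intro card_UN_disjoint) auto
  finally show ?thesis by (simp add: card_B)
qed

section \<open>Polynomials in a subset of the variables\<close>

lemma pconst_in_polys_in: "pconst c \<in> polys_in V"
  by (auto simp: polys_in_def pconst_def)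

lemma one_in_polys_in: "1 \<in> polys_in V"
  by (simp add: polys_in_def)

lemma pvar_in_polys_in: "j \<in> V \<Longrightarrow> pvar j \<in> polys_in V"
  by (simp add: polys_in_def pvar_def)

lemma mult_in_polys_in:
  assumes "p \<in> polys_in V" and "q \<in> polys_in V"
  shows "p * q \<in> polys_in V"
  unfolding polys_in_def
proof (intro CollectI ballI)
  fix t assume "t \<in> keys (p * q)"
  then obtain a b where t_split: "t = a + b" "a \<in> keys p" "b \<in> keys q"
    using keys_mult[of p q] by blast
  then have "keys a \<subseteq> V" "keys b \<subseteq> V"
    using assms by (auto simp: polys_in_def)
  then show "keys t \<subseteq> V"
    unfolding t_split(1) using keys_add[of a b] by blast
qed

lemma prod_pvar_in_polys_in: "S \<subseteq> V \<Longrightarrow> (\<Prod>j\<in>S. pvar j) \<in> polys_in V"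
  by (induction S rule: infinite_finite_induct)
     (simp_all add: one_in_polys_in mult_in_polys_in pvar_in_polys_in)

lemma subspace_polys_in: "cpoly.subspace (polys_in V)"
proof (rule cpoly.subspaceI)
  fix p q and c assume p_in: "p \<in> polys_in V"
  show "cscale c p \<in> polys_in V"
    unfolding cscale_def using p_in by (intro mult_in_polys_in pconst_in_polys_in)
  assume "q \<in> polys_in V"
  with p_in show "p + q \<in> polys_in V"
    using keys_add[of p q] by (auto simp: polys_in_def)
qed (simp add: polys_in_def)

lemma linear_form_in_polys_in: "linear_form_in V p \<Longrightarrow> p \<in> polys_in V"
  by (auto simp: linear_form_in_def
      intro!: cpoly.subspace_sum subspace_polys_in mult_in_polys_in pconst_in_polys_in
        pvar_in_polys_in)

lemma ideal_gen_in_eq_span: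
  "ideal_gen_in V S = cpoly.span {r * s | r s. r \<in> polys_in V \<and> s \<in> S}" (is "_ = cpoly.span ?P")
proof
  show "ideal_gen_in V S \<subseteq> cpoly.span ?P"
    unfolding ideal_gen_in_def
    by (clarify, intro cpoly.span_sum cpoly.span_base) blast
  show "cpoly.span ?P \<subseteq> ideal_gen_in V S"
  proof
    fix p assume "p \<in> cpoly.span ?P"
    then obtain T c where T_subset: "finite T" "T \<subseteq> ?P" and p_eq: "p = (\<Sum>x\<in>T. cscale (c x) x)"
      unfolding cpoly.span_explicit by blast
    have "\<forall>x\<in>T. \<exists>r s. x = r * s \<and> r \<in> polys_in V \<and> s \<in> S" using T_subset(2) by blast
    then obtain r s where factors: "\<And>x. x \<in> T \<Longrightarrow> x = r x * s x \<and> r x \<in> polys_in V \<and> s x \<in> S"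
      by metis
    define R where "R y = (\<Sum>x\<in>{x \<in> T. s x = y}. cscale (c x) (r x))" for y
    have "p = (\<Sum>x\<in>T. cscale (c x) (r x) * s x)"
      unfolding p_eq using factors by (intro sum.cong) (simp_all add: cscale_def mult.assoc)
    also have "\<dots> = (\<Sum>y\<in>s ` T. R y * y)"
      unfolding R_def sum_distrib_right sum.image_gen[OF T_subset(1), of _ s]
      by (intro sum.cong) simp_all
    finally show "p \<in> ideal_gen_in V S"
      unfolding ideal_gen_in_def R_def using T_subset(1) factors
      by (intro CollectI exI[of _ "s ` T"] exI conjI ballI)
         (auto intro!: cpoly.subspace_sum cpoly.subspace_scale subspace_polys_in)
  qed
qed

lemma subspace_ideal_gen_in: "cpoly.subspace (ideal_gen_in V S)"
  by (simp add: ideal_gen_in_eq_span)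

lemma mult_in_ideal_gen_in: "r \<in> polys_in V \<Longrightarrow> s \<in> S \<Longrightarrow> r * s \<in> ideal_gen_in V S"
  unfolding ideal_gen_in_eq_span by (rule cpoly.span_base) blast

lemma ideal_gen_in_base: "s \<in> S \<Longrightarrow> s \<in> ideal_gen_in V S"
  using mult_in_ideal_gen_in[OF one_in_polys_in] by fastforce

lemma ideal_gen_in_absorb:
  assumes "q \<in> polys_in V" and "p \<in> ideal_gen_in V S"
  shows "q * p \<in> ideal_gen_in V S"
  using assms(2) unfolding ideal_gen_in_eq_span
proof (induction rule: cpoly.span_induct_alt)
  case (step c x y)
  then obtain r s where x_eq: "x = r * s" "r \<in> polys_in V" "s \<in> S" by blast
  then have "q * x \<in> cpoly.span {r * s | r s. r \<in> polys_in V \<and> s \<in> S}"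
    using mult_in_ideal_gen_in[OF mult_in_polys_in[OF assms(1)]]
    by (simp add: ideal_gen_in_eq_span flip: mult.assoc)
  moreover have "q * (cscale c x + y) = cscale c (q * x) + q * y"
    by (simp add: cscale_def algebra_simps)
  ultimately show ?case
    using step.IH by (simp add: cpoly.span_add cpoly.span_scale)
qed (simp add: cpoly.span_zero)

lemma ideal_gen_in_minimal:
  assumes "S \<subseteq> ideal_gen_in V T"
  shows "ideal_gen_in V S \<subseteq> ideal_gen_in V T"
  unfolding ideal_gen_in_eq_span[of V S]
  using assms ideal_gen_in_absorb by (intro cpoly.span_minimal subspace_ideal_gen_in) blast

lemma ideal_sum_ideal_gen_in:
  "ideal_sum (ideal_gen_in V S) (ideal_gen_in V T) = ideal_gen_in V (S \<union> T)"
proof -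
  have "{r * s | r s. r \<in> polys_in V \<and> s \<in> S \<union> T}
      = {r * s | r s. r \<in> polys_in V \<and> s \<in> S} \<union> {r * s | r s. r \<in> polys_in V \<and> s \<in> T}"
    by blast
  then show ?thesis
    by (simp only: ideal_gen_in_eq_span cpoly.span_Un ideal_sum_def)
qed

lemma ideal_gen_in_subset_ideal_gen: "ideal_gen_in V S \<subseteq> ideal_gen S"
  unfolding ideal_gen_in_def
  by (auto intro!: ideal.span_sum intro: ideal.span_scale ideal.span_base)

section \<open>Elimination of variables by linear forms\<close>

locale linear_elimination =
  fixes V :: "'n::finite set" and L :: "'n \<Rightarrow> 'n mpoly"
  assumes L_linear: "j \<notin> V \<Longrightarrow> linear_form_in V (L j)"
begin

definition eliminated_var :: "'n \<Rightarrow> 'n mpoly" where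
  "eliminated_var j = (if j \<in> V then pvar j else L j)"

definition eliminate :: "'n mpoly \<Rightarrow> 'n mpoly" where
  "eliminate = mpoly_hom pconst eliminated_var"

definition elimination_forms :: "'n mpoly set" where
  "elimination_forms = (\<lambda>j. pvar j - L j) ` (- V)"

lemma eliminate_pconst: "eliminate (pconst c) = pconst c"
  and eliminate_pvar: "eliminate (pvar j) = eliminated_var j"
  and eliminate_mult: "eliminate (p * q) = eliminate p * eliminate q"
  by (simp_all add: eliminate_def subst.hom_pconst subst.hom_pvar subst.hom_mult)

sublocale eliminate: additive eliminate
  unfolding eliminate_def by (rule subst.hom.additive_axioms)

lemma eliminate_in_polys_in: "eliminate p \<in> polys_in V"
proof (induction p rule: mpoly_induct)
  case (var j p)
  have "eliminated_var j \<in> polys_in V"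
    by (simp add: eliminated_var_def pvar_in_polys_in linear_form_in_polys_in[OF L_linear])
  with var show ?case by (simp add: eliminate_mult eliminate_pvar mult_in_polys_in)
qed (simp_all add: eliminate_pconst pconst_in_polys_in eliminate.add
    cpoly.subspace_add[OF subspace_polys_in])

lemma eliminate_mon_homogeneous: "eliminate (mon u) \<in> homogeneous_part (expo_degree u)"
proof (induction u rule: expo_induct)
  case zero
  show ?case
    using eliminate_pconst[of 1] by (simp add: pconst_def homogeneous_part_def expo_degree_def)
next
  case (unit_add j u)
  have "eliminated_var j \<in> homogeneous_part 1"
    unfolding eliminated_var_def
    using pvar_in_homogeneous_part[of j] linear_form_in_homogeneous_part[OF L_linear, of j] by simp
  from mult_in_homogeneous_part[OF this unit_add] show ?case
    by (simp add: mon_add eliminate_mult expo_degree_add expo_degree_unit_expo eliminate_pvar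
        flip: pvar_eq_mon)
qed

lemma eliminate_cscale: "eliminate (cscale c p) = cscale c (eliminate p)"
  by (simp add: cscale_def eliminate_mult eliminate_pconst)

lemma eliminate_eq_sum: "eliminate p = (\<Sum>u\<in>keys p. cscale (lookup p u) (eliminate (mon u)))"
  using arg_cong[OF sum_cscale_mon[of p], of eliminate]
  by (simp add: eliminate.sum eliminate_cscale)

lemma eliminate_homogeneous:
  assumes "p \<in> homogeneous_part q"
  shows "eliminate p \<in> homogeneous_part q"
  unfolding eliminate_eq_sum[of p] using assms eliminate_mon_homogeneous
  by (intro cpoly.subspace_sum cpoly.subspace_scale subspace_homogeneous_part)
     (auto simp: homogeneous_part_def)

lemma eliminate_mon_id: "keys u \<subseteq> V \<Longrightarrow> eliminate (mon u) = mon u"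
proof (induction u rule: expo_induct)
  case zero
  show ?case using eliminate_pconst[of 1] by (simp add: pconst_def)
next
  case (unit_add j u)
  then have "j \<in> V" "keys u \<subseteq> V" by (simp_all add: keys_unit_expo_add)
  with unit_add.IH show ?case
    by (simp add: mon_add eliminate_mult eliminate_pvar eliminated_var_def flip: pvar_eq_mon)
qed

lemma eliminate_id:
  assumes "p \<in> polys_in V"
  shows "eliminate p = p"
proof -
  have "eliminate p = (\<Sum>u\<in>keys p. cscale (lookup p u) (mon u))"
    unfolding eliminate_eq_sum[of p]
    using assms by (intro sum.cong) (simp_all add: polys_in_def eliminate_mon_id)
  then show ?thesis by (simp add: sum_cscale_mon)
qed

lemma eliminate_congruent: "p - eliminate p \<in> ideal_gen (elimination_forms \<union> S)"
proof (induction p rule: mpoly_induct)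
  case (const c)
  show ?case by (simp add: eliminate_pconst ideal.span_zero)
next
  case (var j p)
  have "pvar j - eliminated_var j \<in> ideal_gen (elimination_forms \<union> S)"
    by (auto simp: eliminated_var_def elimination_forms_def ideal.span_zero intro: ideal.span_base)
  then show ?case
    unfolding eliminate_mult eliminate_pvar by (rule mult_diff_in_ideal_gen[OF _ var])
next
  case (add p q)
  have "p + q - eliminate (p + q) = (p - eliminate p) + (q - eliminate q)"
    by (simp add: eliminate.add)
  then show ?case using add ideal.span_add by metis
qed

lemma eliminate_in_ideal_gen_in:
  assumes S_subset: "S \<subseteq> polys_in V" and p_in_ideal: "p \<in> ideal_gen (elimination_forms \<union> S)"
  shows "eliminate p \<in> ideal_gen_in V S"
  using p_in_ideal
proof (induction rule: ideal.span_induct_alt)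
  case base
  show ?case by (simp add: eliminate.zero cpoly.subspace_0[OF subspace_ideal_gen_in])
next
  case (step r s p)
  have "eliminate r * eliminate s \<in> ideal_gen_in V S"
  proof (cases "s \<in> S")
    case True
    then show ?thesis
      using S_subset
      by (simp add: subset_iff eliminate_id mult_in_ideal_gen_in eliminate_in_polys_in)
  next
    case False
    then obtain j where "j \<notin> V" "s = pvar j - L j"
      using step.hyps(1) by (auto simp: elimination_forms_def)
    then have "eliminate s = 0"
      by (simp add: eliminate.diff eliminate_pvar eliminated_var_def eliminate_id
          linear_form_in_polys_in[OF L_linear])
    then show ?thesis by (simp add: cpoly.subspace_0[OF subspace_ideal_gen_in])
  qed
  then show ?case
    using step.IH
    by (simp add: eliminate.add eliminate_mult cpoly.subspace_add[OF subspace_ideal_gen_in])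
qed

lemma ideal_gen_in_iff_ideal_gen:
  assumes "S \<subseteq> polys_in V" and "p \<in> polys_in V"
  shows "p \<in> ideal_gen_in V S \<longleftrightarrow> p \<in> ideal_gen (elimination_forms \<union> S)"
proof
  assume "p \<in> ideal_gen_in V S"
  then show "p \<in> ideal_gen (elimination_forms \<union> S)"
    using ideal_gen_in_subset_ideal_gen ideal.span_mono[of S "elimination_forms \<union> S"] by blast
next
  assume "p \<in> ideal_gen (elimination_forms \<union> S)"
  from eliminate_in_ideal_gen_in[OF assms(1) this] show "p \<in> ideal_gen_in V S"
    by (simp add: eliminate_id assms(2))
qed

theorem dim_perp_eq_quot_dim:
  assumes S_subset: "S \<subseteq> polys_in V"
    and homogeneous: "elimination_forms \<union> S \<subseteq> (\<Union>d. homogeneous_part d)"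
  shows "cpoly.dim (perp (ideal_gen (elimination_forms \<union> S)) \<inter> homogeneous_part q)
       = quot_dim (polys_in V \<inter> homogeneous_part q) (ideal_gen_in V S)"
proof -
  let ?W = "polys_in V \<inter> homogeneous_part q"
  have subspace_W: "cpoly.subspace ?W"
    by (rule cpoly.subspace_inter[OF subspace_polys_in subspace_homogeneous_part])
  have "?W \<subseteq> cpoly.span (mon ` {u. expo_degree u = q})"
    using homogeneous_part_subset_span by blast
  then obtain B where basis: "quot_basis ?W (ideal_gen_in V S) B"
    using quot_basis_exists[OF _ _ subspace_W subspace_ideal_gen_in]
      finite_imageI[OF finite_expo_degree]
    by metis
  have "card B' = cpoly.dim (perp (ideal_gen (elimination_forms \<union> S)) \<inter> homogeneous_part q)"
    if basis': "quot_basis ?W (ideal_gen_in V S) B'" for B'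
  proof -
    have "quot_basis (homogeneous_part q) (ideal_gen (elimination_forms \<union> S)) B'"
    proof (rule quot_basis_transfer[OF subspace_W subspace_ideal_gen_in subspace_ideal_gen basis'])
      show "\<exists>p'\<in>?W. p - p' \<in> ideal_gen (elimination_forms \<union> S)" if "p \<in> homogeneous_part q" for p
        using eliminate_congruent eliminate_in_polys_in eliminate_homogeneous[OF that] by blast
    qed (use ideal_gen_in_iff_ideal_gen[OF S_subset] in auto)
    from dim_perp_eq_card_quot_basis[OF homogeneous this] show ?thesis by simp
  qed
  then show ?thesis by (rule quot_dim_eqI[OF basis, symmetric])
qed

end

section \<open>Initial ideals of toric ideals\<close>

lemma keys_ideal_gen_mon:
  assumes "p \<in> ideal_gen (mon ` U)" and "t \<in> keys p"
  shows "\<exists>u\<in>U. lookup u \<le> lookup t"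
  using assms
proof (induction arbitrary: t rule: ideal.span_induct_alt)
  case (step r s p)
  then obtain u where s_eq: "u \<in> U" "s = mon u" by blast
  consider (multiple) "t \<in> keys (r * mon u)" | (rest) "t \<in> keys p"
    using step.prems s_eq(2) keys_add[of "r * mon u" p] by blast
  then show ?case
  proof cases
    case multiple
    then obtain c where "t = u + c"
      using keys_mult[of r "mon u"] by (auto simp: add.commute)
    then show ?thesis using s_eq(1) expo_le_iff by blast
  next
    case rest
    then show ?thesis by (rule step.IH)
  qed
qed simp

lemma mon_in_ideal_gen_mon_iff: "mon t \<in> ideal_gen (mon ` U) \<longleftrightarrow> (\<exists>u\<in>U. lookup u \<le> lookup t)"
proof
  assume "\<exists>u\<in>U. lookup u \<le> lookup t"
  then obtain u where u_divides: "u \<in> U" "lookup u \<le> lookup t" by blast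
  then have "mon t = mon (t - u) * mon u"
    using add_diff_expo[OF u_divides(2)] by (simp add: add.commute flip: mon_add)
  then show "mon t \<in> ideal_gen (mon ` U)"
    using u_divides(1) by (simp add: ideal.span_scale ideal.span_base)
qed (use keys_ideal_gen_mon[of "mon t"] in simp)

lemma keys_monomial_ideal: "monomial_ideal M \<Longrightarrow> p \<in> M \<Longrightarrow> t \<in> keys p \<Longrightarrow> mon t \<in> M"
  using keys_ideal_gen_mon mon_in_ideal_gen_mon_iff unfolding monomial_ideal_def by blast

lemma weight_add: "weight w (u + u') = weight w u + weight w u'"
  by (simp add: weight_def lookup_add ring_distribs sum.distrib)

lemma lookup_initial_form:
  "lookup (initial_form w f) u =
     (if \<forall>u'\<in>keys f. weight w u' \<le> weight w u then lookup f u else 0)"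
proof -
  let ?S = "{u \<in> keys f. \<forall>u'\<in>keys f. weight w u' \<le> weight w u}"
  have "lookup (initial_form w f) u = (\<Sum>u'\<in>?S. if u' = u then lookup f u' else 0)"
    unfolding initial_form_def lookup_sum
    by (intro sum.cong) (auto simp: lookup_single when_def)
  also have "\<dots> = (if u \<in> ?S then lookup f u else 0)"
    by (subst sum.delta) simp_all
  finally show ?thesis by (auto simp: in_keys_iff)
qed

lemma lookup_binomial:
  "lookup (mon p - mon m) u = (if u = p then 1 else 0) - (if u = m then 1 else 0)"
  by (simp add: lookup_minus lookup_mon)

lemma keys_binomial: "p \<noteq> m \<Longrightarrow> keys (mon p - mon m) = {p, m}"
  by (auto simp: in_keys_iff lookup_binomial split: if_splits)

lemma initial_form_binomial:
  assumes "weight w m < weight w p"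
  shows "initial_form w (mon p - mon m) = mon p"
proof -
  have "p \<noteq> m" using assms by auto
  then show ?thesis
    using assms by (intro poly_mapping_eqI)
      (auto simp: lookup_initial_form keys_binomial lookup_binomial lookup_mon)
qed

lemma weight_less_of_initial_form_binomial:
  assumes "initial_form w (mon p - mon m) = mon u"
  shows "weight w m < weight w p"
proof (cases "p = m")
  case True
  then have "initial_form w (mon p - mon m) = 0"
    by (simp add: initial_form_def)
  with assms keys_mon[of u] show ?thesis by simp
next
  case False
  have "lookup (initial_form w (mon p - mon m)) m \<noteq> - 1"
    unfolding assms by (simp add: lookup_mon)
  then show ?thesis
    using False by (auto simp: lookup_initial_form lookup_binomial keys_binomial split: if_splits)
qed

lemma initial_form_in_initial_ideal: "f \<in> I \<Longrightarrow> initial_form w f \<in> initial_ideal w I"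
  unfolding initial_ideal_def by (rule ideal.span_base) simp

lemma mon_add_in_initial_ideal: "mon t \<in> initial_ideal w I \<Longrightarrow> mon (u + t) \<in> initial_ideal w I"
  unfolding initial_ideal_def mon_add by (rule ideal.span_scale)

lemma mult_expo_add: "mult_expo A (u + u') = mult_expo A u + mult_expo A u'"
  by (simp add: mult_expo_def vec_eq_iff lookup_add ring_distribs sum.distrib)

definition fiber_sum :: "int ^ 'n::finite ^ 'd::finite \<Rightarrow> int ^ 'd \<Rightarrow> 'n mpoly \<Rightarrow> complex" where
  "fiber_sum A b f = (\<Sum>u\<in>keys f. if mult_expo A u = b then lookup f u else 0)"

interpretation fiber_sum: additive "fiber_sum A b"
proof
  show "fiber_sum A b (f + g) = fiber_sum A b f + fiber_sum A b g" for f g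
    unfolding fiber_sum_def by (rule setsum_keys_plus_distrib) simp_all
qed

lemma fiber_sum_single: "fiber_sum A b (single u c) = (if mult_expo A u = b then c else 0)"
  by (cases "c = 0") (simp_all add: fiber_sum_def)

lemma fiber_sum_toric_ideal:
  assumes "f \<in> toric_ideal A"
  shows "fiber_sum A b f = 0"
  using assms unfolding toric_ideal_def
proof (induction rule: ideal.span_induct_alt)
  case (step r s p)
  then obtain u u' where s_eq: "s = mon u - mon u'" and same_fiber: "mult_expo A u = mult_expo A u'"
    by blast
  have "fiber_sum A b (r * s) = 0"
  proof (induction r rule: poly_mapping_induct)
    case (single t c)
    have "single t c * s = single (t + u) c - single (t + u') c"
      by (simp add: s_eq mon_def ring_distribs mult_single)
    then show ?case by (simp add: fiber_sum.diff fiber_sum_single mult_expo_add same_fiber)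
  qed (simp add: ring_distribs fiber_sum.add)
  then show ?case using step.IH by (simp add: fiber_sum.add)
qed (rule fiber_sum.zero)

lemma binomial_in_toric_ideal_iff:
  "mon p - mon m \<in> toric_ideal A \<longleftrightarrow> mult_expo A p = mult_expo A m"
proof
  assume "mon p - mon m \<in> toric_ideal A"
  from fiber_sum_toric_ideal[OF this, of "mult_expo A p"]
  show "mult_expo A p = mult_expo A m"
    by (simp add: fiber_sum.diff mon_def fiber_sum_single split: if_splits)
qed (auto simp: toric_ideal_def intro: ideal.span_base)

lemma generic_weight_binomial:
  assumes generic: "generic_weight A w" and toric: "mon p - mon m \<in> toric_ideal A" and "p \<noteq> m"
  shows "\<exists>t\<in>{p, m}. mon t \<in> initial_ideal w (toric_ideal A)"
proof -
  have "\<exists>t\<in>{p, m}. t \<in> keys (initial_form w (mon p - mon m))"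
    using \<open>p \<noteq> m\<close> linear[of "weight w p" "weight w m"]
    by (auto simp: in_keys_iff lookup_initial_form keys_binomial lookup_binomial)
  then show ?thesis
    using generic keys_monomial_ideal initial_form_in_initial_ideal[OF toric]
    unfolding generic_weight_def by blast
qed

section \<open>Linear independence of columns\<close>

definition columns_independent :: "int ^ 'n::finite ^ 'd::finite \<Rightarrow> 'n set \<Rightarrow> bool" where
  "columns_independent A \<sigma> \<longleftrightarrow>
     (\<forall>z. (\<forall>i. (\<Sum>k\<in>\<sigma>. A $ i $ k * z k) = 0) \<longrightarrow> (\<forall>k\<in>\<sigma>. z k = 0))"

lemma columns_independent_mono:
  assumes independent: "columns_independent A \<sigma>" and subset: "\<tau> \<subseteq> \<sigma>"
  shows "columns_independent A \<tau>"
  unfolding columns_independent_def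
proof (intro allI impI ballI)
  fix z k assume kernel: "\<forall>i. (\<Sum>k\<in>\<tau>. A $ i $ k * z k) = 0" and k_in: "k \<in> \<tau>"
  let ?z = "\<lambda>k. if k \<in> \<tau> then z k else 0"
  have "(\<Sum>k\<in>\<sigma>. A $ i $ k * ?z k) = (\<Sum>k\<in>\<tau>. A $ i $ k * z k)" for i
    using subset by (intro sum.mono_neutral_cong_right) auto
  then have "\<forall>i. (\<Sum>k\<in>\<sigma>. A $ i $ k * ?z k) = 0" using kernel by simp
  with independent[unfolded columns_independent_def, THEN spec, of ?z]
  have "\<forall>k\<in>\<sigma>. ?z k = 0" by (rule mp)
  then have "?z k = 0" using k_in subset by blast
  then show "z k = 0" using k_in by simp
qed

text \<open>A kernel vector supported on the face of a standard pair gives a binomial in the toric ideal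
  one of whose monomials, both supported on that face, lies in the monomial initial ideal.\<close>

lemma standard_pair_columns_independent:
  fixes A :: "int ^ 'n::finite ^ 'd::finite"
  assumes generic: "generic_weight A w"
    and pair: "(a, \<sigma>) \<in> standard_pairs (initial_ideal w (toric_ideal A))"
  shows "columns_independent A \<sigma>"
  unfolding columns_independent_def
proof (intro allI impI ballI, rule ccontr)
  fix z k assume kernel: "\<forall>i. (\<Sum>k\<in>\<sigma>. A $ i $ k * z k) = 0" and k_nonzero: "k \<in> \<sigma>" "z k \<noteq> 0"
  define p :: "'n expo" where "p = Abs_poly_mapping (\<lambda>j. if j \<in> \<sigma> then nat (z j) else 0)"
  define m :: "'n expo" where "m = Abs_poly_mapping (\<lambda>j. if j \<in> \<sigma> then nat (- z j) else 0)"
  have lookup_p: "lookup p j = (if j \<in> \<sigma> then nat (z j) else 0)"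
    and lookup_m: "lookup m j = (if j \<in> \<sigma> then nat (- z j) else 0)" for j
    by (simp_all add: p_def m_def)
  have "(mult_expo A p - mult_expo A m) $ i = (\<Sum>j\<in>\<sigma>. A $ i $ j * z j)" for i
  proof -
    have "(mult_expo A p - mult_expo A m) $ i
        = (\<Sum>j\<in>UNIV. A $ i $ j * (int (lookup p j) - int (lookup m j)))"
      by (simp add: mult_expo_def sum_subtractf right_diff_distrib)
    also have "\<dots> = (\<Sum>j\<in>\<sigma>. A $ i $ j * z j)"
      by (rule sum.mono_neutral_cong_right) (auto simp: lookup_p lookup_m)
    finally show ?thesis .
  qed
  then have "mult_expo A p = mult_expo A m"
    using kernel by (simp add: vec_eq_iff)
  then have "mon p - mon m \<in> toric_ideal A"
    by (simp add: binomial_in_toric_ideal_iff)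
  moreover have "lookup p k \<noteq> lookup m k"
    using k_nonzero by (simp add: lookup_p lookup_m)
  ultimately obtain t where t_initial: "t \<in> {p, m}" "mon t \<in> initial_ideal w (toric_ideal A)"
    using generic_weight_binomial[OF generic] by blast
  then have "mon (a + t) \<in> initial_ideal w (toric_ideal A)"
    by (intro mon_add_in_initial_ideal)
  moreover have "keys t \<subseteq> \<sigma>"
    using t_initial(1) by (auto simp: in_keys_iff lookup_p lookup_m split: if_splits)
  ultimately show False
    using pair by (auto simp: standard_pairs_def)
qed

lemma common_denominator:
  fixes r :: "'a \<Rightarrow> rat"
  assumes "finite S"
  shows "\<exists>N::int. N \<noteq> 0 \<and> (\<forall>k\<in>S. of_int N * r k \<in> \<int>)"
  using assms
proof (induction S)
  case empty
  show ?case by (rule exI[of _ 1]) simp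
next
  case (insert x S)
  then obtain N :: int where N_clears: "N \<noteq> 0" "\<forall>k\<in>S. of_int N * r k \<in> \<int>" by blast
  obtain a b where b_pos: "b > 0" and r_x_eq: "r x = of_int a / of_int b"
    by (metis Rat_cases Fract_of_int_quotient)
  have "of_int (b * N) * r k \<in> \<int>" if "k \<in> insert x S" for k
  proof (cases "k = x")
    case True
    then have "of_int (b * N) * r k = of_int (N * a)" using b_pos by (simp add: r_x_eq)
    then show ?thesis by (metis Ints_of_int)
  next
    case False
    with that N_clears(2) have "of_int N * r k \<in> \<int>" by simp
    from Ints_mult[OF Ints_of_int[of b] this] show ?thesis by (simp add: mult.assoc)
  qed
  moreover have "b * N \<noteq> 0" using N_clears(1) b_pos by simp
  ultimately show ?case by blast
qed

lemma columns_independent_rat: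
  fixes r :: "'n::finite \<Rightarrow> rat"
  assumes independent: "columns_independent A \<sigma>"
    and comb_zero: "(\<Sum>k\<in>\<sigma>. r k *s column k (rat_matrix A)) = 0" and k_in: "k \<in> \<sigma>"
  shows "r k = 0"
proof -
  obtain N :: int where N_clears: "N \<noteq> 0" "\<forall>k\<in>\<sigma>. of_int N * r k \<in> \<int>"
    using common_denominator[of \<sigma> r] by auto
  then have "\<forall>k\<in>\<sigma>. \<exists>z. of_int N * r k = of_int z"
    by (metis Ints_cases)
  then obtain z where z_eq: "\<And>k. k \<in> \<sigma> \<Longrightarrow> of_int N * r k = of_int (z k)"
    by metis
  have "(\<Sum>k\<in>\<sigma>. A $ i $ k * z k) = 0" for i
  proof -
    have "rat_of_int (\<Sum>k\<in>\<sigma>. A $ i $ k * z k) = (\<Sum>k\<in>\<sigma>. of_int N * (r k * of_int (A $ i $ k)))"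
      unfolding of_int_sum by (rule sum.cong) (simp_all add: z_eq[symmetric] mult_ac)
    also have "\<dots> = of_int N * ((\<Sum>k\<in>\<sigma>. r k *s column k (rat_matrix A)) $ i)"
      by (simp add: sum_distrib_left column_def rat_matrix_def)
    also have "\<dots> = 0" unfolding comb_zero by simp
    finally show ?thesis by (simp only: of_int_eq_0_iff)
  qed
  then have "z k = 0"
    using independent k_in unfolding columns_independent_def by blast
  then show ?thesis using z_eq[OF k_in] N_clears(1) by simp
qed

lemma columns_independent_inj_on:
  assumes "columns_independent A \<sigma>"
  shows "inj_on (\<lambda>k. column k (rat_matrix A)) \<sigma>"
proof (rule inj_onI, rule ccontr)
  let ?col = "\<lambda>k. column k (rat_matrix A)"
  fix k l assume collision: "k \<in> \<sigma>" "l \<in> \<sigma>" "?col k = ?col l" "k \<noteq> l"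
  have "(\<Sum>m\<in>\<sigma>. ((if m = k then 1 else 0) - (if m = l then 1 else 0)) *s ?col m) = 0"
    using collision by (simp add: vec_eq_iff left_diff_distrib sum_subtractf
        if_distrib[of "\<lambda>x. x * _"] cong: if_cong)
  from columns_independent_rat[OF assms this collision(1)] collision(4) show False by simp
qed

lemma columns_independent_imp_independent:
  assumes "columns_independent A \<sigma>"
  shows "vec.independent ((\<lambda>k. column k (rat_matrix A)) ` \<sigma>)"
proof (rule vec.independent_if_scalars_zero)
  let ?col = "\<lambda>k. column k (rat_matrix A)"
  fix f x assume comb_zero: "(\<Sum>x\<in>?col ` \<sigma>. f x *s x) = 0" and "x \<in> ?col ` \<sigma>"
  then obtain k where "k \<in> \<sigma>" "x = ?col k" by blast
  then show "f x = 0"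
    using columns_independent_rat[OF assms, of "\<lambda>k. f (?col k)"] comb_zero
    by (simp add: sum.reindex[OF columns_independent_inj_on[OF assms]])
qed simp

lemma dual_row_combination:
  fixes A :: "int ^ 'n::finite ^ 'd::finite"
  assumes independent: "columns_independent A \<sigma>" and j_in: "j \<in> \<sigma>"
  shows "\<exists>y :: 'd \<Rightarrow> rat. \<forall>k\<in>\<sigma>. (\<Sum>i\<in>UNIV. y i * of_int (A $ i $ k)) = (if k = j then 1 else 0)"
proof -
  let ?col = "\<lambda>k. column k (rat_matrix A)"
  interpret vector_space_pair "(*s) :: rat \<Rightarrow> rat ^ 'd \<Rightarrow> rat ^ 'd" "(*) :: rat \<Rightarrow> rat \<Rightarrow> rat"
    by unfold_locales
  obtain g where g_dual: "Vector_Spaces.linear (*s) (*) g"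
      "\<forall>x\<in>?col ` \<sigma>. g x = (if x = ?col j then 1 else 0)"
    using linear_independent_extend[OF columns_independent_imp_independent[OF independent],
        of "\<lambda>x. if x = ?col j then 1 else 0"] by blast
  interpret g: Vector_Spaces.linear "(*s) :: rat \<Rightarrow> rat ^ 'd \<Rightarrow> rat ^ 'd" "(*) :: rat \<Rightarrow> rat \<Rightarrow> rat" g
    by (rule g_dual(1))
  have "(\<Sum>i\<in>UNIV. g (axis i 1) * of_int (A $ i $ k)) = (if k = j then 1 else 0)"
    if k_in: "k \<in> \<sigma>" for k
  proof -
    have "(\<Sum>i\<in>UNIV. g (axis i 1) * of_int (A $ i $ k)) = g (\<Sum>i\<in>UNIV. (?col k $ i) *s axis i 1)"
      by (simp add: g.sum g.scale column_def rat_matrix_def mult.commute)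
    also have "\<dots> = g (?col k)"
      by (simp add: basis_expansion)
    also have "\<dots> = (if k = j then 1 else 0)"
      using g_dual(2) k_in inj_on_eq_iff[OF columns_independent_inj_on[OF independent] k_in j_in]
      by simp
    finally show ?thesis .
  qed
  then show ?thesis by (intro exI[of _ "\<lambda>i. g (axis i 1)"] ballI)
qed

lemma row_form_combination:
  "(\<Sum>i\<in>UNIV. pconst (y i) * row_form A i)
     = (\<Sum>k\<in>UNIV. pconst (\<Sum>i\<in>UNIV. y i * of_int (A $ i $ k)) * pvar k)"
proof -
  have "(\<Sum>i\<in>UNIV. pconst (y i) * row_form A i)
      = (\<Sum>i\<in>UNIV. \<Sum>k\<in>UNIV. pconst (y i * of_int (A $ i $ k)) * pvar k)"
    by (simp add: row_form_def sum_distrib_left subst.coeff_mult mult.assoc)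
  also have "\<dots> = (\<Sum>k\<in>UNIV. pconst (\<Sum>i\<in>UNIV. y i * of_int (A $ i $ k)) * pvar k)"
    by (subst sum.swap) (simp add: subst.coeff.sum sum_distrib_right)
  finally show ?thesis .
qed

lemma row_form_solve_for_pvar:
  fixes A :: "int ^ 'n::finite ^ 'd::finite"
  assumes "columns_independent A \<sigma>" and j_in: "j \<in> \<sigma>"
  shows "\<exists>c. pvar j + (\<Sum>k\<in>- \<sigma>. pconst (c k) * pvar k) \<in> ideal_gen (range (row_form A))"
proof -
  obtain y :: "'d \<Rightarrow> rat"
    where y_dual: "\<forall>k\<in>\<sigma>. (\<Sum>i\<in>UNIV. y i * of_int (A $ i $ k)) = (if k = j then 1 else 0)"
    using dual_row_combination[OF assms] ..
  define c :: "'n \<Rightarrow> complex" where "c k = (\<Sum>i\<in>UNIV. of_rat (y i) * of_int (A $ i $ k))" for k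
  have c_eq: "c k = (if k = j then 1 else 0)" if "k \<in> \<sigma>" for k
  proof -
    have "c k = of_rat (\<Sum>i\<in>UNIV. y i * of_int (A $ i $ k))"
      by (simp add: c_def of_rat_sum of_rat_mult)
    then show ?thesis using y_dual that by simp
  qed
  have "(\<Sum>i\<in>UNIV. pconst (of_rat (y i)) * row_form A i) = (\<Sum>k\<in>UNIV. pconst (c k) * pvar k)"
    unfolding c_def by (rule row_form_combination)
  also have "\<dots> = (\<Sum>k\<in>- \<sigma>. pconst (c k) * pvar k) + (\<Sum>k\<in>\<sigma>. pconst (c k) * pvar k)"
    using sum.subset_diff[of \<sigma> UNIV "\<lambda>k. pconst (c k) * pvar k"] by (simp add: Compl_eq_Diff_UNIV)
  also have "(\<Sum>k\<in>\<sigma>. pconst (c k) * pvar k) = (\<Sum>k\<in>\<sigma>. if k = j then pvar j else 0)"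
    by (rule sum.cong) (simp_all add: c_eq subst.coeff_one subst.coeff.zero)
  also have "\<dots> = pvar j" using j_in by simp
  finally have "pvar j + (\<Sum>k\<in>- \<sigma>. pconst (c k) * pvar k)
      = (\<Sum>i\<in>UNIV. pconst (of_rat (y i)) * row_form A i)"
    by (simp add: add.commute)
  also have "\<dots> \<in> ideal_gen (range (row_form A))"
    by (intro ideal.span_sum ideal.span_scale ideal.span_base) simp
  finally show ?thesis by blast
qed

section \<open>Linear systems of parameters\<close>

lemma mon_in_ideal_gen_of_nonface:
  assumes "(\<Prod>j\<in>keys u. pvar j) \<in> ideal_gen S"
  shows "mon u \<in> ideal_gen S"
proof -
  define e where "e = (\<Sum>j\<in>keys u. unit_expo j)"
  have "lookup e \<le> lookup u"
    by (auto simp: le_fun_def e_def lookup_sum lookup_unit_expo in_keys_iff)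
  then have "mon u = mon (u - e) * (\<Prod>j\<in>keys u. pvar j)"
    using add_diff_expo[of e u] by (simp add: prod_pvar add.commute flip: e_def mon_add)
  then show ?thesis using assms by (simp add: ideal.span_scale)
qed

text \<open>A repeated variable can be traded for variables outside the support,
  so that the support grows until it is no longer a face.\<close>

lemma mon_in_ideal_gen_of_face_forms:
  fixes S :: "'n::finite mpoly set"
  assumes nonface: "\<And>\<tau>. \<tau> \<notin> \<Delta> \<Longrightarrow> (\<Prod>j\<in>\<tau>. pvar j) \<in> ideal_gen S"
    and face_form: "\<And>\<tau> j. \<tau> \<in> \<Delta> \<Longrightarrow> j \<in> \<tau> \<Longrightarrow>
      \<exists>c. pvar j + (\<Sum>k\<in>- \<tau>. pconst (c k) * pvar k) \<in> ideal_gen S"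
  shows "CARD('n) < expo_degree u \<Longrightarrow> mon u \<in> ideal_gen S"
proof (induction "card (- keys u)" arbitrary: u rule: less_induct)
  case less
  show ?case
  proof (cases "keys u \<in> \<Delta>")
    case False
    then show ?thesis by (intro mon_in_ideal_gen_of_nonface nonface)
  next
    case True
    obtain j where j_repeated: "1 < lookup u j"
      using exists_lookup_gt_one[OF less.prems] ..
    define t where "t = u - unit_expo j"
    have u_eq: "u = unit_expo j + t"
      using j_repeated unfolding t_def by (intro unit_expo_add_diff[symmetric]) simp
    have keys_t: "keys t = keys u"
      using j_repeated by (auto simp: u_eq in_keys_iff lookup_add lookup_unit_expo split: if_splits)
    obtain c where c_form: "pvar j + (\<Sum>k\<in>- keys u. pconst (c k) * pvar k) \<in> ideal_gen S"
      using face_form[OF True, of j] j_repeated by (auto simp: in_keys_iff)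
    have IH: "mon (unit_expo k + t) \<in> ideal_gen S" if k_outside: "k \<in> - keys u" for k
    proof (rule less.hyps)
      show "card (- keys (unit_expo k + t)) < card (- keys u)"
        using k_outside by (intro psubset_card_mono) (auto simp: keys_unit_expo_add keys_t)
      show "CARD('n) < expo_degree (unit_expo k + t)"
        using less.prems by (simp add: u_eq expo_degree_add expo_degree_unit_expo)
    qed
    have "mon u = mon t * (pvar j + (\<Sum>k\<in>- keys u. pconst (c k) * pvar k))
        - (\<Sum>k\<in>- keys u. pconst (c k) * mon (unit_expo k + t))"
      by (subst u_eq) (simp add: mon_add pvar_eq_mon distrib_left sum_distrib_left mult_ac)
    also have "\<dots> \<in> ideal_gen S"
      using c_form IH by (intro ideal.span_diff ideal.span_sum ideal.span_scale) auto
    finally show ?thesis .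
  qed
qed

section \<open>Extension to standard pairs\<close>

lemma standard_pair_extending:
  fixes a :: "'n::finite expo"
  assumes free: "\<And>b. keys b \<subseteq> \<tau> \<Longrightarrow> mon (restrict_expo (- \<tau>) a + b) \<notin> ideal_gen S"
  shows "\<exists>\<sigma>. \<tau> \<subseteq> \<sigma> \<and> (restrict_expo (- \<sigma>) a, \<sigma>) \<in> standard_pairs (ideal_gen S)"
proof -
  define P where "P \<sigma> \<longleftrightarrow> \<tau> \<subseteq> \<sigma> \<and>
    (\<forall>b. keys b \<subseteq> \<sigma> \<longrightarrow> mon (restrict_expo (- \<sigma>) a + b) \<notin> ideal_gen S)" for \<sigma>
  have "P \<tau>" using free by (simp add: P_def)
  then obtain \<sigma> where P_\<sigma>: "P \<sigma>" and maximal: "\<And>\<sigma>'. P \<sigma>' \<Longrightarrow> card \<sigma>' \<le> card \<sigma>"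
    using ex_has_greatest_nat[of P \<tau> card "Suc CARD('n)"] by (auto simp: less_Suc_eq_le card_mono)
  have "\<exists>b. keys b \<subseteq> insert l \<sigma> \<and> mon (restrict_expo (- \<sigma>) a + b) \<in> ideal_gen S"
    if l_notin: "l \<notin> \<sigma>" for l
  proof -
    have "\<not> P (insert l \<sigma>)" using maximal[of "insert l \<sigma>"] l_notin by auto
    then obtain b where keys_b: "keys b \<subseteq> insert l \<sigma>"
      and in_ideal: "mon (restrict_expo (- insert l \<sigma>) a + b) \<in> ideal_gen S"
      using P_\<sigma> by (auto simp: P_def)
    have "restrict_expo (- \<sigma>) a = restrict_expo {l} a + restrict_expo (- insert l \<sigma>) a"
      using l_notin by (intro poly_mapping_eqI) (auto simp: lookup_add lookup_restrict_expo)
    then have "mon (restrict_expo (- \<sigma>) a + b) \<in> ideal_gen S"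
      using in_ideal by (simp add: mon_add mult.assoc ideal.span_scale)
    with keys_b show ?thesis by blast
  qed
  then have "(restrict_expo (- \<sigma>) a, \<sigma>) \<in> standard_pairs (ideal_gen S)"
    using P_\<sigma> unfolding standard_pairs_def P_def by (simp add: lookup_restrict_expo)
  then show ?thesis using P_\<sigma> unfolding P_def by blast
qed

section \<open>The link of a fake exponent\<close>

lemma mem_nsupp_of_int_iff: "v $ j = of_int z \<Longrightarrow> j \<in> nsupp v \<longleftrightarrow> z < 0"
  by (auto simp: nsupp_def)

lemma mem_G_set_iff:
  assumes "lookup p j = 0 \<or> lookup m j = 0"
  shows "j \<in> G_set v p m \<longleftrightarrow> (\<exists>a<lookup p j. v $ j = of_nat a)"
proof (cases "v $ j \<in> \<int>")
  case True
  then obtain z where v_j_eq: "v $ j = of_int z" by (rule Ints_cases)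
  then have "(\<chi> j. v $ j + of_int ((- (\<chi> j. int (lookup p j) - int (lookup m j))) $ j)) $ j
      = of_int (z - int (lookup p j) + int (lookup m j))" by simp
  then have "j \<in> G_set v p m \<longleftrightarrow> z - int (lookup p j) + int (lookup m j) < 0 \<and> 0 \<le> z"
    using v_j_eq unfolding G_set_def nsupp_shift_def
    by (simp only: Diff_iff mem_nsupp_of_int_iff not_less)
  also have "\<dots> \<longleftrightarrow> 0 \<le> z \<and> z < int (lookup p j)"
    using assms by auto
  also have "\<dots> \<longleftrightarrow> (\<exists>a<lookup p j. z = int a)"
    by (metis int_nat_eq nat_int nat_less_iff of_nat_0_le_iff of_nat_less_iff)
  also have "\<dots> \<longleftrightarrow> (\<exists>a<lookup p j. v $ j = of_nat a)"
    unfolding v_j_eq by (metis of_int_eq_iff of_int_of_nat_eq)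
  finally show ?thesis .
next
  case False
  have "v $ j \<in> \<int>" if "j \<in> nsupp_shift v u" for u
  proof -
    from that obtain k :: int where "v $ j + of_int (u $ j) = of_int k"
      by (auto simp: nsupp_shift_def nsupp_def)
    then have "v $ j = of_int (k - u $ j)" by (simp add: algebra_simps)
    then show ?thesis by simp
  qed
  then show ?thesis using False by (auto simp: G_set_def)
qed

locale toric_groebner_basis =
  fixes A :: "int ^ 'n::finite ^ 'd::finite" and w :: "real ^ 'n"
    and m :: nat and gp gm :: "nat \<Rightarrow> 'n expo"
  assumes generic: "generic_weight A w"
    and reduced: "is_reduced_groebner_basis w (toric_ideal A)
      ((\<lambda>i. mon (gp i) - mon (gm i)) ` {1..m})"
begin

abbreviation binomial :: "nat \<Rightarrow> 'n mpoly" where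
  "binomial i \<equiv> mon (gp i) - mon (gm i)"

abbreviation G :: "complex ^ 'n \<Rightarrow> nat \<Rightarrow> 'n set" where
  "G v i \<equiv> G_set v (gp i) (gm i)"

lemma weight_gm_less_gp: "i \<in> {1..m} \<Longrightarrow> weight w (gm i) < weight w (gp i)"
  using reduced weight_less_of_initial_form_binomial
  unfolding is_reduced_groebner_basis_def by blast

lemma initial_form_gp: "i \<in> {1..m} \<Longrightarrow> initial_form w (binomial i) = mon (gp i)"
  by (rule initial_form_binomial[OF weight_gm_less_gp])

lemma mon_in_initial_ideal_iff:
  "mon t \<in> initial_ideal w (toric_ideal A) \<longleftrightarrow> (\<exists>i\<in>{1..m}. lookup (gp i) \<le> lookup t)"
proof -
  have "initial_form w ` binomial ` {1..m} = mon ` gp ` {1..m}"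
    unfolding image_image by (rule image_cong) (simp_all add: initial_form_gp)
  then have "initial_ideal w (toric_ideal A) = ideal_gen (mon ` gp ` {1..m})"
    using reduced unfolding is_reduced_groebner_basis_def by metis
  then show ?thesis by (simp add: mon_in_ideal_gen_mon_iff)
qed

lemma gp_minimal:
  assumes i_in: "i \<in> {1..m}"
    and t_initial: "mon t \<in> initial_ideal w (toric_ideal A)" "lookup t \<le> lookup (gp i)"
  shows "t = gp i"
proof (rule ccontr)
  assume "t \<noteq> gp i"
  obtain k where k_in: "k \<in> {1..m}" and gp_k_le: "lookup (gp k) \<le> lookup t"
    using t_initial(1) unfolding mon_in_initial_ideal_iff by blast
  have "gp k \<noteq> gp i"
    using \<open>t \<noteq> gp i\<close> gp_k_le t_initial(2) by (metis antisym lookup_inject)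
  then have "binomial k \<noteq> binomial i"
    using initial_form_gp[OF i_in] initial_form_gp[OF k_in] by (metis mon_eq_iff)
  then have "mon (gp k) \<in> ideal_gen (initial_form w ` (binomial ` {1..m} - {binomial i}))"
    using k_in
    by (subst initial_form_gp[OF k_in, symmetric]) (intro ideal.span_base imageI DiffI, auto)
  moreover have "mon (gp i) = mon (gp i - gp k) * mon (gp k)"
    using add_diff_expo[OF order_trans[OF gp_k_le t_initial(2)]]
    by (simp add: add.commute flip: mon_add)
  ultimately have "mon (gp i) \<in> ideal_gen (initial_form w ` (binomial ` {1..m} - {binomial i}))"
    by (simp add: ideal.span_scale)
  moreover have "gp i \<in> keys (binomial i)"
    using weight_gm_less_gp[OF i_in] by (subst keys_binomial) auto
  ultimately show False
    using reduced i_in unfolding is_reduced_groebner_basis_def by blast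
qed

text \<open>A common variable could be cancelled from the binomial, leaving a smaller leading monomial.\<close>

lemma gp_gm_disjoint:
  assumes i_in: "i \<in> {1..m}"
  shows "lookup (gp i) j = 0 \<or> lookup (gm i) j = 0"
proof (rule ccontr)
  assume "\<not> ?thesis"
  then obtain p' m' where gp_i_eq: "gp i = unit_expo j + p'" and gm_i_eq: "gm i = unit_expo j + m'"
    by (metis unit_expo_add_diff)
  have "binomial i \<in> toric_ideal A"
    using reduced i_in ideal.span_base[of "binomial i" "binomial ` {1..m}"]
    unfolding is_reduced_groebner_basis_def by blast
  then have "mon p' - mon m' \<in> toric_ideal A"
    by (simp add: binomial_in_toric_ideal_iff gp_i_eq gm_i_eq mult_expo_add)
  moreover have "weight w m' < weight w p'"
    using weight_gm_less_gp[OF i_in] by (simp add: gp_i_eq gm_i_eq weight_add)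
  ultimately have "mon p' \<in> initial_ideal w (toric_ideal A)"
    using initial_form_in_initial_ideal[of _ "toric_ideal A" w] initial_form_binomial by metis
  moreover have "lookup p' \<le> lookup (gp i)"
    by (simp add: gp_i_eq le_fun_def lookup_add)
  ultimately have "p' = gp i" by (rule gp_minimal[OF i_in])
  then have "expo_degree p' = 1 + expo_degree p'"
    by (metis gp_i_eq expo_degree_add expo_degree_unit_expo)
  then show False by simp
qed

lemma mem_G_iff:
  "i \<in> {1..m} \<Longrightarrow> j \<in> G v i \<longleftrightarrow> (\<exists>a<lookup (gp i) j. v $ j = of_nat a)"
  by (rule mem_G_set_iff[OF gp_gm_disjoint])

lemma G_nonempty:
  assumes fake: "fake_exponent A \<beta> w v" and i_in: "i \<in> {1..m}"
  shows "G v i \<noteq> {}"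
proof -
  have "mon (gp i) \<in> initial_ideal w (toric_ideal A)"
    unfolding mon_in_initial_ideal_iff using i_in by blast
  then have "eval_mpoly v (falling_poly (gp i)) = 0"
    using fake falling_poly_in_fake_indicial_ideal unfolding fake_exponent_def by blast
  then obtain j where "\<exists>k<lookup (gp i) j. v $ j = of_nat k"
    unfolding eval_falling_poly_eq_0_iff ..
  then have "j \<in> G v i"
    by (simp only: mem_G_iff[OF i_in])
  then show ?thesis by blast
qed

lemma G_not_subset_face:
  assumes pair: "(a, \<sigma>) \<in> standard_pairs_at A w v" and i_in: "i \<in> {1..m}"
  shows "\<not> G v i \<subseteq> \<sigma>"
proof
  assume G_subset: "G v i \<subseteq> \<sigma>"
  let ?b = "restrict_expo \<sigma> (gp i)"
  have "lookup (gp i) j \<le> lookup (a + ?b) j" for j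
  proof (cases "j \<in> \<sigma>")
    case False
    then have "v $ j = of_nat (lookup a j)" "j \<notin> G v i"
      using pair G_subset by (auto simp: standard_pairs_at_def)
    then have "lookup (gp i) j \<le> lookup a j"
      using mem_G_iff[OF i_in] not_less by blast
    then show ?thesis by (simp add: lookup_add)
  qed (simp add: lookup_add lookup_restrict_expo)
  then have "mon (a + ?b) \<in> initial_ideal w (toric_ideal A)"
    unfolding mon_in_initial_ideal_iff using i_in by (intro bexI[of _ i] le_funI)
  moreover have "keys ?b \<subseteq> \<sigma>" by (simp add: keys_restrict_expo)
  ultimately show False
    using pair by (auto simp: standard_pairs_at_def standard_pairs_def)
qed

lemma exists_natural_coordinates:
  fixes v :: "complex ^ 'n::finite"
  shows "\<exists>a :: 'n expo. \<forall>j. v $ j \<in> \<nat> \<longrightarrow> v $ j = of_nat (lookup a j)"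
proof -
  have "\<forall>j. \<exists>k::nat. v $ j \<in> \<nat> \<longrightarrow> v $ j = of_nat k"
    by (metis Nats_cases)
  then obtain f :: "'n \<Rightarrow> nat" where "\<forall>j. v $ j \<in> \<nat> \<longrightarrow> v $ j = of_nat (f j)"
    by metis
  then show ?thesis by (intro exI[of _ "Abs_poly_mapping f"]) simp
qed

lemma standard_pair_at_extending:
  assumes no_G_subset: "\<forall>i\<in>{1..m}. \<not> G v i \<subseteq> \<tau>"
  shows "\<exists>(a, \<sigma>)\<in>standard_pairs_at A w v. \<tau> \<subseteq> \<sigma>"
proof -
  define N where "N = {j. v $ j \<in> \<nat>}"
  obtain a :: "'n expo" where a_eq: "\<And>j. j \<in> N \<Longrightarrow> v $ j = of_nat (lookup a j)"
    using exists_natural_coordinates[of v] by (auto simp: N_def)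
  let ?\<tau> = "\<tau> \<union> - N"
  have "mon (restrict_expo (- ?\<tau>) a + b) \<notin> initial_ideal w (toric_ideal A)"
    if keys_b: "keys b \<subseteq> ?\<tau>" for b
  proof
    assume "mon (restrict_expo (- ?\<tau>) a + b) \<in> initial_ideal w (toric_ideal A)"
    then obtain i where gp_i_le: "i \<in> {1..m}" "lookup (gp i) \<le> lookup (restrict_expo (- ?\<tau>) a + b)"
      unfolding mon_in_initial_ideal_iff by blast
    obtain j where "j \<in> G v i" and j_notin: "j \<notin> \<tau>"
      using no_G_subset gp_i_le(1) by blast
    then obtain k where v_j_eq: "k < lookup (gp i) j" "v $ j = of_nat k"
      unfolding mem_G_iff[OF gp_i_le(1)] by blast
    then have "j \<in> N" by (auto simp: N_def)
    then have "lookup a j = k" using a_eq[of j] v_j_eq(2) by simp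
    moreover have "lookup b j = 0"
      using keys_b j_notin \<open>j \<in> N\<close> by (auto simp: in_keys_iff subset_iff)
    ultimately have "lookup (gp i) j \<le> k"
      using le_funD[OF gp_i_le(2), of j] j_notin \<open>j \<in> N\<close>
      by (simp add: lookup_add lookup_restrict_expo)
    with v_j_eq(1) show False by simp
  qed
  from standard_pair_extending[OF this[unfolded initial_ideal_def]]
  obtain \<sigma> where \<sigma>_superset: "?\<tau> \<subseteq> \<sigma>"
    and pair: "(restrict_expo (- \<sigma>) a, \<sigma>) \<in> standard_pairs (initial_ideal w (toric_ideal A))"
    unfolding initial_ideal_def by blast
  have "v $ j = of_nat (lookup (restrict_expo (- \<sigma>) a) j)" if "j \<notin> \<sigma>" for j
    using a_eq[of j] \<sigma>_superset that by (auto simp: lookup_restrict_expo)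
  with pair have "(restrict_expo (- \<sigma>) a, \<sigma>) \<in> standard_pairs_at A w v"
    by (simp add: standard_pairs_at_def)
  then show ?thesis using \<sigma>_superset by blast
qed

lemma Delta_complex_iff:
  "\<tau> \<in> Delta_complex A w v \<longleftrightarrow> (\<forall>i\<in>{1..m}. \<not> G v i \<subseteq> \<tau>)"
proof
  assume "\<tau> \<in> Delta_complex A w v"
  then show "\<forall>i\<in>{1..m}. \<not> G v i \<subseteq> \<tau>"
    unfolding Delta_complex_def using G_not_subset_face by blast
next
  assume "\<forall>i\<in>{1..m}. \<not> G v i \<subseteq> \<tau>"
  then show "\<tau> \<in> Delta_complex A w v"
    unfolding Delta_complex_def by (intro CollectI standard_pair_at_extending)
qed

lemma link_complex_iff:
  assumes "\<tau> \<subseteq> - nsupp v"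
  shows "\<tau> \<in> link_complex A w v \<longleftrightarrow> (\<forall>i\<in>{1..m}. \<not> G v i \<subseteq> \<tau>)"
proof -
  have "G v i \<subseteq> \<tau> \<union> nsupp v \<longleftrightarrow> G v i \<subseteq> \<tau>" for i
    by (auto simp: G_set_def)
  then show ?thesis
    using assms by (auto simp: link_complex_def Delta_complex_iff)
qed

lemma Delta_complex_columns_independent:
  "\<tau> \<in> Delta_complex A w v \<Longrightarrow> columns_independent A \<tau>"
  unfolding Delta_complex_def standard_pairs_at_def
  using standard_pair_columns_independent[OF generic] columns_independent_mono by blast

definition G_monomials :: "complex ^ 'n \<Rightarrow> 'n mpoly set" where
  "G_monomials v = (\<lambda>i. \<Prod>j\<in>G v i. pvar j) ` {1..m}"

lemma M_ideal_eq: "M_ideal v m gp gm = ideal_gen (G_monomials v)"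
  by (simp add: M_ideal_def G_monomials_def)

lemma G_monomials_in_polys_in: "G_monomials v \<subseteq> polys_in (- nsupp v)"
  unfolding G_monomials_def by (auto simp: G_set_def intro!: prod_pvar_in_polys_in)

lemma G_monomials_homogeneous:
  assumes "fake_exponent A \<beta> w v" and "s \<in> G_monomials v"
  shows "\<exists>d>0. s \<in> homogeneous_part d"
proof -
  obtain i where i_in: "i \<in> {1..m}" and s_eq: "s = (\<Prod>j\<in>G v i. pvar j)"
    using assms(2) unfolding G_monomials_def by blast
  let ?u = "\<Sum>j\<in>G v i. unit_expo j"
  have "0 < expo_degree ?u"
    using G_nonempty[OF assms(1) i_in] by (simp add: expo_degree_sum_unit_expo card_gt_0_iff)
  then show ?thesis
    unfolding s_eq prod_pvar using mon_in_homogeneous_part by blast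
qed

lemma stanley_reisner_ideal_link:
  "stanley_reisner_ideal (- nsupp v) (link_complex A w v)
     = ideal_gen_in (- nsupp v) (G_monomials v)"
proof
  let ?V = "- nsupp v"
  show "stanley_reisner_ideal ?V (link_complex A w v) \<subseteq> ideal_gen_in ?V (G_monomials v)"
    unfolding stanley_reisner_ideal_def
  proof (rule ideal_gen_in_minimal, clarify)
    fix \<tau> assume \<tau>_nonface: "\<tau> \<subseteq> ?V" "\<tau> \<notin> link_complex A w v"
    then obtain i where i_in: "i \<in> {1..m}" "G v i \<subseteq> \<tau>"
      using link_complex_iff by blast
    have "(\<Prod>j\<in>\<tau>. pvar j) = (\<Prod>j\<in>\<tau> - G v i. pvar j) * (\<Prod>j\<in>G v i. pvar j :: 'n mpoly)"
      by (rule prod.subset_diff[OF i_in(2)]) simp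
    also have "\<dots> \<in> ideal_gen_in ?V (G_monomials v)"
    proof (rule mult_in_ideal_gen_in)
      show "(\<Prod>j\<in>\<tau> - G v i. pvar j) \<in> polys_in ?V"
        using \<tau>_nonface(1) by (intro prod_pvar_in_polys_in) blast
      show "(\<Prod>j\<in>G v i. pvar j) \<in> G_monomials v" using i_in(1) unfolding G_monomials_def by blast
    qed
    finally show "(\<Prod>j\<in>\<tau>. pvar j) \<in> ideal_gen_in ?V (G_monomials v)" .
  qed
  show "ideal_gen_in ?V (G_monomials v) \<subseteq> stanley_reisner_ideal ?V (link_complex A w v)"
    unfolding stanley_reisner_ideal_def
  proof (rule ideal_gen_in_minimal, rule subsetI)
    fix s assume "s \<in> G_monomials v"
    then obtain i where i_in: "i \<in> {1..m}" and s_eq: "s = (\<Prod>j\<in>G v i. pvar j)"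
      unfolding G_monomials_def by blast
    have G_subset_V: "G v i \<subseteq> ?V" by (auto simp: G_set_def)
    then have "G v i \<notin> link_complex A w v"
      using link_complex_iff[OF G_subset_V] i_in by blast
    then show "s \<in> ideal_gen_in ?V {(\<Prod>i\<in>\<tau>. pvar i) | \<tau>. \<tau> \<subseteq> ?V \<and> \<tau> \<notin> link_complex A w v}"
      using G_subset_V s_eq by (intro ideal_gen_in_base) blast
  qed
qed

text \<open>The faces of \<open>\<Delta>\<^sub>w(v)\<close> index independent columns, so the row forms are a linear system of
  parameters for its Stanley--Reisner ring.\<close>

lemma homogeneous_part_subset_Q_ideal:
  assumes "CARD('n) < q"
  shows "homogeneous_part q \<subseteq> Q_ideal A v m gp gm"
proof -
  let ?S = "range (row_form A) \<union> G_monomials v"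
  have Q_eq_rows: "Q_ideal A v m gp gm = ideal_gen ?S"
    by (simp add: Q_ideal_def M_ideal_eq ideal_sum_ideal_gen)
  have nonface: "(\<Prod>j\<in>\<tau>. pvar j) \<in> ideal_gen ?S" if \<tau>_nonface: "\<tau> \<notin> Delta_complex A w v" for \<tau>
  proof -
    obtain i where G_subset: "i \<in> {1..m}" "G v i \<subseteq> \<tau>"
      using \<tau>_nonface unfolding Delta_complex_iff by blast
    then have "(\<Prod>j\<in>G v i. pvar j) \<in> ideal_gen ?S"
      by (intro ideal.span_base) (simp add: G_monomials_def)
    then show ?thesis
      unfolding prod.subset_diff[OF G_subset(2) finite] by (rule ideal.span_scale)
  qed
  have face_form: "\<exists>c. pvar j + (\<Sum>k\<in>- \<tau>. pconst (c k) * pvar k) \<in> ideal_gen ?S"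
    if \<tau>_face: "\<tau> \<in> Delta_complex A w v" "j \<in> \<tau>" for \<tau> j
    using row_form_solve_for_pvar[OF Delta_complex_columns_independent[OF \<tau>_face(1)] \<tau>_face(2)]
      ideal.span_mono[of "range (row_form A)" ?S] by blast
  have "p \<in> ideal_gen ?S" if "p \<in> homogeneous_part q" for p
  proof -
    have "mon u \<in> ideal_gen ?S" if "u \<in> keys p" for u
      using mon_in_ideal_gen_of_face_forms[OF nonface face_form, where u = u] assms that
        \<open>p \<in> homogeneous_part q\<close> by (simp add: homogeneous_part_def)
    then have "(\<Sum>u\<in>keys p. cscale (lookup p u) (mon u)) \<in> ideal_gen ?S"
      by (intro cpoly.subspace_sum cpoly.subspace_scale subspace_ideal_gen)
    then show ?thesis by (simp add: sum_cscale_mon)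
  qed
  then show ?thesis unfolding Q_eq_rows by blast
qed

end

section \<open>The Hilbert series\<close>

lemma degree_eq_Max_coeff:
  assumes "p \<noteq> 0"
  shows "degree p = Max {q. coeff p q \<noteq> 0}"
proof (rule Max_eqI[symmetric])
  show "finite {q. coeff p q \<noteq> 0}"
    by (rule finite_subset[of _ "{..degree p}"]) (auto intro: le_degree)
qed (use assms in \<open>auto intro: le_degree\<close>)

lemma poly_one_eq_sum_coeff:
  fixes p :: "'a::comm_semiring_1 poly"
  assumes "degree p \<le> N"
  shows "poly p 1 = (\<Sum>q\<le>N. coeff p q)"
proof -
  have "(\<Sum>q\<le>degree p. coeff p q) = (\<Sum>q\<le>N. coeff p q)"
    using assms by (intro sum.mono_neutral_left) (auto intro: coeff_eq_0)
  then show ?thesis by (simp add: poly_altdef)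
qed

locale fake_exponent_link = toric_groebner_basis A w m gp gm
  for A :: "int ^ 'n::finite ^ 'd::finite" and w :: "real ^ 'n"
    and m :: nat and gp gm :: "nat \<Rightarrow> 'n expo" +
  fixes \<beta> :: "complex ^ 'd" and v :: "complex ^ 'n"
    and L :: "'n \<Rightarrow> 'n mpoly" and ell :: "nat \<Rightarrow> 'n mpoly"
  assumes fake: "fake_exponent A \<beta> w v"
    and row_reduced: "row_reduction A (nsupp v) L ell"
begin

sublocale linear_elimination "- nsupp v" L
  using row_reduced by unfold_locales (simp add: row_reduction_def)

abbreviation "Q \<equiv> Q_ideal A v m gp gm"

abbreviation "perp_part q \<equiv> perp Q \<inter> homogeneous_part q"

definition link_generators :: "'n mpoly set" where
  "link_generators = G_monomials v \<union> ell ` {1..CARD('d) - card (nsupp v)}"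

lemma link_quotient_ideal_eq:
  "link_quotient_ideal A w v ell = ideal_gen_in (- nsupp v) link_generators"
  unfolding link_quotient_ideal_def stanley_reisner_ideal_link ideal_sum_ideal_gen_in
    link_generators_def ..

lemma Q_eq: "Q = ideal_gen (elimination_forms \<union> link_generators)"
proof -
  have "ideal_gen (range (row_form A))
      = ideal_gen (elimination_forms \<union> ell ` {1..CARD('d) - card (nsupp v)})"
    using row_reduced by (simp add: row_reduction_def elimination_forms_def)
  then show ?thesis
    unfolding Q_ideal_def M_ideal_eq link_generators_def by (simp add: ideal_sum_ideal_gen Un_ac)
qed

lemma ell_linear: "s \<in> ell ` {1..CARD('d) - card (nsupp v)} \<Longrightarrow> linear_form_in (- nsupp v) s"
  using row_reduced unfolding row_reduction_def by blast

lemma link_generators_in_polys_in: "link_generators \<subseteq> polys_in (- nsupp v)"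
  unfolding link_generators_def
  using G_monomials_in_polys_in linear_form_in_polys_in[OF ell_linear] by blast

lemma generators_homogeneous:
  assumes "s \<in> elimination_forms \<union> link_generators"
  shows "\<exists>d>0. s \<in> homogeneous_part d"
proof -
  consider (elimination) j where "j \<in> nsupp v" "s = pvar j - L j"
    | (link) "s \<in> G_monomials v" | (row) "linear_form_in (- nsupp v) s"
    using assms ell_linear by (auto simp: elimination_forms_def link_generators_def)
  then show ?thesis
  proof cases
    case elimination
    then have "s \<in> homogeneous_part 1"
      using cpoly.subspace_diff[OF subspace_homogeneous_part pvar_in_homogeneous_part
          linear_form_in_homogeneous_part[OF L_linear]] by simp
    then show ?thesis by (intro exI[of _ 1]) simp
  next
    case link
    then show ?thesis by (rule G_monomials_homogeneous[OF fake])
  next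
    case row
    then show ?thesis
      using linear_form_in_homogeneous_part by (intro exI[of _ 1]) simp
  qed
qed

lemma generators_homogeneous_UN: "elimination_forms \<union> link_generators \<subseteq> (\<Union>d. homogeneous_part d)"
  using generators_homogeneous by blast

lemma H_series_eq:
  "H_series A w v ell = Abs_fps (\<lambda>q. int (cpoly.dim (perp_part q)))"
  unfolding H_series_def hilbert_series_def link_quotient_ideal_eq Q_eq
  by (simp add: dim_perp_eq_quot_dim[OF link_generators_in_polys_in generators_homogeneous_UN])

lemma homogeneous_component_perp_Q_eq_0:
  "f \<in> perp Q \<Longrightarrow> CARD('n) < q \<Longrightarrow> homogeneous_component q f = 0"
  using homogeneous_component_perp_eq_0[of q "elimination_forms \<union> link_generators" f]
    homogeneous_part_subset_Q_ideal[of q v] by (simp add: Q_eq)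

lemma dim_perp_part_eq_0_iff:
  "cpoly.dim (perp_part q) = 0 \<longleftrightarrow> perp_part q = {0}"
proof -
  have "perp_part q \<subseteq> cpoly.span (mon ` {u. expo_degree u = q})"
    using homogeneous_part_subset_span by blast
  then have "cpoly.dim (perp_part q) = 0 \<longleftrightarrow> perp_part q \<subseteq> {0}"
    by (rule dim_eq_0_iff[OF finite_imageI[OF finite_expo_degree]])
  moreover have "0 \<in> perp_part q"
    unfolding Q_eq by (simp add: cpoly.subspace_0 subspace_perp subspace_homogeneous_part)
  ultimately show ?thesis by blast
qed

lemma dim_perp_part_eq_0:
  assumes "CARD('n) < q"
  shows "cpoly.dim (perp_part q) = 0"
proof -
  have "f = 0" if "f \<in> perp Q" "f \<in> homogeneous_part q" for f
    using homogeneous_component_perp_Q_eq_0[OF that(1) assms]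
      homogeneous_component_of_part[OF that(2), of q] by simp
  then show ?thesis
    using cpoly.dim_le_card[of "perp_part q" "{}"] by auto
qed

lemma coeff_H_poly: "coeff (H_poly A w v ell) q = int (cpoly.dim (perp_part q))"
proof -
  define h where "h q = int (cpoly.dim (perp_part q))" for q
  have coeff: "coeff (\<Sum>q\<le>CARD('n). monom (h q) q) k = h k" for k
    using dim_perp_part_eq_0[of k] by (auto simp: coeff_sum h_def not_le)
  then have "fps_of_poly (\<Sum>q\<le>CARD('n). monom (h q) q) = H_series A w v ell"
    unfolding H_series_eq by (intro fps_ext) (simp add: h_def)
  then have "H_poly A w v ell = (\<Sum>q\<le>CARD('n). monom (h q) q)"
    unfolding H_poly_def by (intro the_equality) (simp_all flip: fps_of_poly_eq_iff)
  with coeff show ?thesis by (simp add: h_def)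
qed

lemma one_in_perp_Q: "1 \<in> perp Q"
  unfolding Q_eq by (rule one_in_perp_ideal_gen[OF generators_homogeneous])

lemma fdeg_eq: "fdeg A w v ell = Max {q. perp_part q \<noteq> {0}}"
proof -
  have support: "coeff (H_poly A w v ell) q \<noteq> 0 \<longleftrightarrow> perp_part q \<noteq> {0}" for q
    by (simp add: coeff_H_poly dim_perp_part_eq_0_iff)
  have "1 \<in> perp_part 0"
    using one_in_perp_Q one_in_homogeneous_part by blast
  then have "perp_part 0 \<noteq> {0}"
    by (metis singletonD zero_neq_one)
  then have "H_poly A w v ell \<noteq> 0"
    using support[of 0] by auto
  then show ?thesis
    unfolding fdeg_def support[symmetric] by (rule degree_eq_Max_coeff)
qed

lemma frank_eq: "int (frank A v m gp gm) = poly (H_poly A w v ell) 1"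
proof -
  have "cpoly.dim (perp Q) = (\<Sum>q\<le>CARD('n). cpoly.dim (perp_part q))"
    using homogeneous_component_perp_Q_eq_0
      homogeneous_component_in_perp[OF generators_homogeneous_UN]
    unfolding Q_eq by (intro dim_graded_subspace)
  moreover have "degree (H_poly A w v ell) \<le> CARD('n)"
    by (rule degree_le) (simp add: coeff_H_poly dim_perp_part_eq_0)
  ultimately show ?thesis
    by (simp add: frank_def poly_one_eq_sum_coeff coeff_H_poly)
qed

end

theorem theorem4p7:
  fixes A :: "int ^ 'n::finite ^ 'd::finite"
    and \<beta> :: "complex ^ 'd"
    and w :: "real ^ 'n"
    and v :: "complex ^ 'n"
    and m :: nat
    and gp gm :: "nat \<Rightarrow> ('n \<Rightarrow>\<^sub>0 nat)"
    and L :: "'n \<Rightarrow> 'n mpoly"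
    and ell :: "nat \<Rightarrow> 'n mpoly"
  assumes "rank (rat_matrix A) = CARD('d)"
    and "homogeneous_matrix A"
    and "generic_weight A w"
    and "fake_exponent A \<beta> w v"
    and "is_reduced_groebner_basis w (toric_ideal A) ((\<lambda>i. mon (gp i) - mon (gm i)) ` {1..m})"
    and "\<forall>i\<in>{1..m}. mon (gp i) \<in> initial_ideal w (toric_ideal A)"
    and "row_reduction A (nsupp v) L ell"
  shows
    "Abs_fps (\<lambda>q. int (cpoly.dim (perp (Q_ideal A v m gp gm) \<inter> homogeneous_part q)))
        = H_series A w v ell \<and>
     Max {q. perp (Q_ideal A v m gp gm) \<inter> homogeneous_part q \<noteq> {0}} = fdeg A w v ell \<and>
     int (frank A v m gp gm) = poly (H_poly A w v ell) 1"
proof -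
  interpret fake_exponent_link A w m gp gm \<beta> v L ell
    using assms by unfold_locales
  show ?thesis
    using H_series_eq fdeg_eq frank_eq by simp
qed

end
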